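(* Let $F(x)=\sum_{i=1}^mF_i(x)$, $x\in\mathbb R^d$, with $F_i=\frac1n\sum_{j=1}^nf_{ij}$, where the functions $f_{ij}:\mathbb R^d\to\mathbb R$ are differentiable and possibly nonconvex. Suppose that each $F_i$ is $L$-smooth, i.e. $\|\nabla F_i(u)-\nabla F_i(v)\|\le L\|u-v\|$ for all $u,v$; that each $F_i$ is $\hat L$-average smooth, i.e. $\frac1n\sum_{j=1}^n\|\nabla f_{ij}(u)-\nabla f_{ij}(v)\|^2\le\hat L^2\|u-v\|^2$ for all $u,v$; and that the gossip matrices $W(k)$ satisfy the gossip assumption with constant $\chi\ge1$ (see context). Then algorithm GT-PAGE (see context; minibatch size $b$, probability $p$, suitably chosen step size $\eta$) requires $N$ iterations to yield $\hat x^N$, which is taken uniformly at random from $\{\bar x^k\}_{k=0}^{N-1}$, such that $\mathbb E\|\nabla F(\hat x^N)\|^2\le\varepsilon^2$, where $$N=\mathcal O\left(\frac{\chi^3L\Delta\left(1+\sqrt{\frac{(1-p)\hat L^2}{bpL^2}}\right)}{\varepsilon^2}\right),$$ $\Delta=F(x_0)-F^*$, $x_0\in\mathbb R^d$ is the common starting point of all nodes, $F^*=\inf F$, and $\bar x^k=\frac1m\sum_{i=1}^mx_i^k$.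
   Context: There are $m$ nodes; node $i$ holds $F_i$ and a copy $x_i\in\mathbb R^d$ of each variable. Algorithm variables are $x=(x_1,\dots,x_m)\in(\mathbb R^d)^m$, and $\mathbf G(x):=(\nabla F_1(x_1),\dots,\nabla F_m(x_m))$. $\|\cdot\|$ is the Euclidean norm, $I_m$ the identity matrix, $\otimes$ the Kronecker product. Gossip assumption with constant $\chi\ge1$: there are graphs $\mathcal G^k=(\{1,\dots,m\},\mathcal E^k)$, $k=0,1,2,\dots$, and matrices $W(k)\in\mathbb R^{m\times m}$ such that for every $k$: (1) $[W(k)]_{ij}\ne0$ if and only if $(i,j)\in\mathcal E^k$ or $i=j$; (2) $\ker W(k)\supset\{(a_1,\dots,a_m)\in\mathbb R^m:a_1=\dots=a_m\}$; (3) $\mathrm{range}\,W(k)\subset\{a\in\mathbb R^m:\sum_ia_i=0\}$; (4) $\|(W(k)\otimes I_d)x-x\|^2\le(1-\chi^{-1})\|x\|^2$ for all $x\in(\mathbb R^d)^m$ with $\sum_ix_i=0$. Algorithm GT-PAGE (step size $\eta$, minibatch size $b$, probability $p$). Initialize $x^0=(x_0,\dots,x_0)$, $y^0=\mathbf G(x^0)$, and $v^0$ with all $m$ blocks equal to $\frac1m\sum_{i=1}^my_i^0$. For $k=0,1,\dots,N-1$: $x^{k+1}=((I_m-W(k))\otimes I_d)x^k-\eta v^k$; each node $i$ samples a batch $S_i^k$ of $b$ independent indices, each uniform on $\{1,\dots,n\}$, and sets $(\nabla^k)_i=y_i^k+\frac1b\sum_{j\in S_i^k}(\nabla f_{ij}(x_i^{k+1})-\nabla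 f_{ij}(x_i^k))$; $y^{k+1}=\mathbf G(x^{k+1})$ with probability $p$, and $y^{k+1}=\nabla^k$ with probability $1-p$; $v^{k+1}=((I_m-W(k))\otimes I_d)v^k+y^{k+1}-y^k$.
   Formalization: The constant hidden in the O-notation may depend on the number m of nodes: since F is the sum (not the average) of the F_i, a bound with a constant independent of m is false, e.g. when all F_i are identical. *)

theory Defs
  imports "HOL-Probability.Probability"
begin

text \<open>
  The constant hidden in the O-notation must not depend on the dimension d, so d has to be
  quantified after that constant and cannot be a type. We therefore realise every R^d as the
  coordinate subspace \<open>Rd d\<close> (first d coordinates) of the inner product space
  of finitely supported real sequences, with the standard inner product.
\<close>

typedef fseq = "{a :: nat \<Rightarrow> real. finite {i. a i \<noteq> 0}}"
  morphisms coord Abs_fseq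
  by (rule exI[of _ "\<lambda>_. 0"]) simp

lemma finite_coord: "finite {i. coord x i \<noteq> 0}"
  using coord[of x] by simp

lemma coord_Abs: "finite {i. a i \<noteq> 0} \<Longrightarrow> coord (Abs_fseq a) = a"
  by (simp add: Abs_fseq_inverse)

lemma fseq_eq_iff: "x = y \<longleftrightarrow> (\<forall>i. coord x i = coord y i)"
  using coord_inject[of x y] by auto

instantiation fseq :: real_vector
begin

definition zero_fseq :: fseq where "0 = Abs_fseq (\<lambda>_. 0)"
definition plus_fseq :: "fseq \<Rightarrow> fseq \<Rightarrow> fseq" where
  "x + y = Abs_fseq (\<lambda>i. coord x i + coord y i)"
definition uminus_fseq :: "fseq \<Rightarrow> fseq" where
  "- x = Abs_fseq (\<lambda>i. - coord x i)"
definition minus_fseq :: "fseq \<Rightarrow> fseq \<Rightarrow> fseq" where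
  "x - y = Abs_fseq (\<lambda>i. coord x i - coord y i)"
definition scaleR_fseq :: "real \<Rightarrow> fseq \<Rightarrow> fseq" where
  "c *\<^sub>R x = Abs_fseq (\<lambda>i. c * coord x i)"

lemma coord_simps [simp]:
  "coord 0 i = 0"
  "coord (x + y) i = coord x i + coord y i"
  "coord (- x) i = - coord x i"
  "coord (x - y) i = coord x i - coord y i"
  "coord (c *\<^sub>R x) i = c * coord x i"
proof -
  have fin: "finite ({i. coord x i \<noteq> 0} \<union> {i. coord y i \<noteq> 0})"
    by (simp add: finite_coord)
  show "coord 0 i = 0"
    by (simp add: zero_fseq_def coord_Abs)
  have "finite {i. coord x i + coord y i \<noteq> 0}"
    by (rule finite_subset[OF _ fin]) auto
  then show "coord (x + y) i = coord x i + coord y i"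
    by (simp add: plus_fseq_def coord_Abs)
  have "finite {i. coord x i - coord y i \<noteq> 0}"
    by (rule finite_subset[OF _ fin]) auto
  then show "coord (x - y) i = coord x i - coord y i"
    by (simp add: minus_fseq_def coord_Abs)
  show "coord (- x) i = - coord x i"
    by (simp add: uminus_fseq_def coord_Abs finite_coord)
  have "finite {i. c * coord x i \<noteq> 0}"
    by (rule finite_subset[OF _ fin]) auto
  then show "coord (c *\<^sub>R x) i = c * coord x i"
    by (simp add: scaleR_fseq_def coord_Abs)
qed

instance
  by standard (simp_all add: fseq_eq_iff algebra_simps)

end

instantiation fseq :: real_inner
begin

definition inner_fseq :: "fseq \<Rightarrow> fseq \<Rightarrow> real" where
  "inner x y = (\<Sum>i | coord x i \<noteq> 0. coord x i * coord y i)"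
definition norm_fseq :: "fseq \<Rightarrow> real" where
  "norm (x::fseq) = sqrt (inner x x)"
definition sgn_fseq :: "fseq \<Rightarrow> fseq" where
  "sgn (x::fseq) = x /\<^sub>R norm x"
definition dist_fseq :: "fseq \<Rightarrow> fseq \<Rightarrow> real" where
  "dist (x::fseq) y = norm (x - y)"
definition uniformity_fseq :: "(fseq \<times> fseq) filter" where
  "uniformity = (INF e\<in>{0<..}. principal {(x::fseq, y). dist x y < e})"
definition open_fseq :: "fseq set \<Rightarrow> bool" where
  "open (U::fseq set) \<longleftrightarrow> (\<forall>x\<in>U. \<forall>\<^sub>F (x', y) in uniformity. x' = x \<longrightarrow> y \<in> U)"

lemma inner_fseq_superset:
  assumes "finite A" "{i. coord x i \<noteq> 0} \<subseteq> A"
  shows "inner x y = (\<Sum>i\<in>A. coord x i * coord y i)"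
  unfolding inner_fseq_def using assms by (intro sum.mono_neutral_left) auto

instance
proof
  fix r :: real and x y z :: fseq and U :: "fseq set"
  let ?A = "{i. coord x i \<noteq> 0} \<union> {i. coord y i \<noteq> 0}"
  have A: "finite ?A" by (simp add: finite_coord)
  show "dist x y = norm (x - y)" by (fact dist_fseq_def)
  show "sgn x = x /\<^sub>R norm x" by (fact sgn_fseq_def)
  show "(uniformity :: (fseq \<times> fseq) filter) = (INF e\<in>{0<..}. principal {(x::fseq, y). dist x y < e})"
    by (fact uniformity_fseq_def)
  show "open U \<longleftrightarrow> (\<forall>x\<in>U. \<forall>\<^sub>F (x', y) in uniformity. x' = x \<longrightarrow> y \<in> U)"
    by (fact open_fseq_def)
  have xy: "inner x z = (\<Sum>i\<in>?A. coord x i * coord z i)"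
    "inner y z = (\<Sum>i\<in>?A. coord y i * coord z i)" for z
    by (auto intro!: inner_fseq_superset A)
  show "inner x y = inner y x"
    unfolding xy by (simp add: mult.commute)
  have "inner (x + y) z = (\<Sum>i\<in>?A. coord (x + y) i * coord z i)"
    by (rule inner_fseq_superset[OF A]) auto
  then show "inner (x + y) z = inner x z + inner y z"
    unfolding xy by (simp add: distrib_right sum.distrib)
  have "inner (r *\<^sub>R x) y = (\<Sum>i\<in>?A. coord (r *\<^sub>R x) i * coord y i)"
    by (rule inner_fseq_superset[OF A]) auto
  then show "inner (r *\<^sub>R x) y = r * inner x y"
    unfolding xy by (simp add: sum_distrib_left mult.assoc)
  show "0 \<le> inner x x"
    by (simp add: inner_fseq_def sum_nonneg)
  show "inner x x = 0 \<longleftrightarrow> x = 0"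
    by (auto simp: inner_fseq_def sum_nonneg_eq_0_iff finite_coord fseq_eq_iff)
  show "norm x = sqrt (inner x x)"
    by (fact norm_fseq_def)
qed

end

definition Rd :: "nat \<Rightarrow> fseq set" where
  "Rd d = {x. \<forall>i\<ge>d. coord x i = 0}"

text \<open>
  Below, \<open>V\<close> is a linear subspace playing the role of R^d, and only the values on \<open>V\<close> of the
  functions involved matter. Requiring \<open>g \<in> V\<close> makes the gradient unique.
\<close>

definition grad :: "'a::real_inner set \<Rightarrow> ('a \<Rightarrow> real) \<Rightarrow> 'a \<Rightarrow> 'a" where
  "grad V f x = (THE g. g \<in> V \<and> (f has_derivative (\<lambda>h. g \<bullet> h)) (at x within V))"

lemma grad_eqI:
  assumes "subspace V" "x \<in> V" "g \<in> V" "(f has_derivative (\<lambda>h. g \<bullet> h)) (at x within V)"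
  shows "grad V f x = g"
  unfolding grad_def
proof (rule the_equality)
  show "g \<in> V \<and> (f has_derivative (\<lambda>h. g \<bullet> h)) (at x within V)"
    using assms by simp
next
  fix g' assume g': "g' \<in> V \<and> (f has_derivative (\<lambda>h. g' \<bullet> h)) (at x within V)"
  define h where "h = g' - g"
  have hV: "h \<in> V" using assms g' by (simp add: h_def subspace_diff)
  let ?l = "\<lambda>t::real. x + t *\<^sub>R h"
  have sub: "range ?l \<subseteq> V"
    using assms hV by (auto intro: subspace_add subspace_scale)
  have l: "(?l has_derivative (\<lambda>t. t *\<^sub>R h)) (at 0)"
    by (auto intro!: derivative_eq_intros)
  have "((\<lambda>t. f (?l t)) has_derivative (\<lambda>t. k \<bullet> (t *\<^sub>R h))) (at 0)"
    if "(f has_derivative (\<lambda>h. k \<bullet> h)) (at x within V)" for k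
  proof -
    have "(f has_derivative (\<lambda>h. k \<bullet> h)) (at (?l 0) within range ?l)"
      using has_derivative_subset[OF that sub] by simp
    from has_derivative_in_compose[OF l this] show ?thesis by simp
  qed
  from this[of g] this[of g'] assms g'
  have "(\<lambda>t. g \<bullet> (t *\<^sub>R h)) = (\<lambda>t. g' \<bullet> (t *\<^sub>R h))"
    by (intro has_derivative_unique) auto
  from fun_cong[OF this, of 1] have "h \<bullet> h = 0"
    by (simp add: h_def inner_diff_left)
  then show "g' = g" by (simp add: h_def)
qed

text \<open>\<open>f i j\<close> is the j-th summand of node i; the index j ranges over \<open>{1..n}\<close>.\<close>

definition node_obj :: "nat \<Rightarrow> ('m \<Rightarrow> nat \<Rightarrow> 'a \<Rightarrow> real) \<Rightarrow> 'm \<Rightarrow> 'a \<Rightarrow> real" where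
  "node_obj n f i u = (\<Sum>j=1..n. f i j u) / real n"

definition obj :: "nat \<Rightarrow> ('m::finite \<Rightarrow> nat \<Rightarrow> 'a \<Rightarrow> real) \<Rightarrow> 'a \<Rightarrow> real" where
  "obj n f u = (\<Sum>i\<in>UNIV. node_obj n f i u)"

definition L_smooth :: "'a::real_inner set \<Rightarrow> ('a \<Rightarrow> real) \<Rightarrow> real \<Rightarrow> bool" where
  "L_smooth V F L \<longleftrightarrow>
     (\<forall>u\<in>V. \<forall>v\<in>V. norm (grad V F u - grad V F v) \<le> L * norm (u - v))"

definition average_smooth ::
    "'a::real_inner set \<Rightarrow> nat \<Rightarrow> (nat \<Rightarrow> 'a \<Rightarrow> real) \<Rightarrow> real \<Rightarrow> bool" where
  "average_smooth V n g Lhat \<longleftrightarrow>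
     (\<forall>u\<in>V. \<forall>v\<in>V. (\<Sum>j=1..n. (norm (grad V (g j) u - grad V (g j) v))\<^sup>2) / real n
        \<le> Lhat\<^sup>2 * (norm (u - v))\<^sup>2)"

text \<open>
  The nodes are the elements of the finite type \<open>'m\<close>, and an element of \<open>'a ^ 'm\<close> is a stack of
  one vector per node, with the Euclidean norm. \<open>kron_apply A x\<close> is the product of A (x) I_d with x.
  The edge sets \<open>E k\<close> are arbitrary relations, so directed and undirected graphs are both covered.
\<close>

definition kron_apply :: "real ^ 'm ^ 'm \<Rightarrow> 'a::real_vector ^ 'm \<Rightarrow> 'a ^ 'm" where
  "kron_apply A x = (\<chi> i. \<Sum>j\<in>UNIV. (A $ i $ j) *\<^sub>R (x $ j))"

definition gossip ::
    "'a::real_inner set \<Rightarrow> (nat \<Rightarrow> ('m::finite \<times> 'm) set) \<Rightarrow> (nat \<Rightarrow> real ^ 'm ^ 'm) \<Rightarrow> real \<Rightarrow> bool"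
  where
  "gossip V E W chi \<longleftrightarrow> (\<forall>k.
     (\<forall>i j. W k $ i $ j \<noteq> 0 \<longleftrightarrow> (i, j) \<in> E k \<or> i = j) \<and>
     {a. \<forall>i j. a $ i = a $ j} \<subseteq> {a. W k *v a = 0} \<and>
     range (\<lambda>a. W k *v a) \<subseteq> {a. (\<Sum>i\<in>UNIV. a $ i) = 0} \<and>
     (\<forall>x :: 'a ^ 'm. (\<forall>i. x $ i \<in> V) \<and> (\<Sum>i\<in>UNIV. x $ i) = 0 \<longrightarrow>
        (norm (kron_apply (W k) x - x))\<^sup>2 \<le> (1 - 1 / chi) * (norm x)\<^sup>2))"

definition node_avg :: "'a::real_vector ^ 'm::finite \<Rightarrow> 'a" where
  "node_avg x = (1 / real CARD('m)) *\<^sub>R (\<Sum>i\<in>UNIV. x $ i)"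

definition stacked_grad ::
    "'a::real_inner set \<Rightarrow> nat \<Rightarrow> ('m::finite \<Rightarrow> nat \<Rightarrow> 'a \<Rightarrow> real) \<Rightarrow> 'a ^ 'm \<Rightarrow> 'a ^ 'm" where
  "stacked_grad V n f x = (\<chi> i. grad V (node_obj n f i) (x $ i))"

text \<open>States are triples (x, y, v).\<close>

type_synonym ('a, 'm) gt_state = "('a ^ 'm) \<times> ('a ^ 'm) \<times> ('a ^ 'm)"

definition gt_page_init ::
    "'a::real_inner set \<Rightarrow> nat \<Rightarrow> ('m::finite \<Rightarrow> nat \<Rightarrow> 'a \<Rightarrow> real) \<Rightarrow> 'a \<Rightarrow> ('a, 'm) gt_state" where
  "gt_page_init V n f x0 =
     (let x = (\<chi> i. x0); y = stacked_grad V n f x in (x, y, \<chi> i. node_avg y))"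

definition gt_page_minibatch ::
    "'a::real_inner set \<Rightarrow> ('m::finite \<Rightarrow> nat \<Rightarrow> 'a \<Rightarrow> real) \<Rightarrow> nat \<Rightarrow> ('m \<times> nat \<Rightarrow> nat) \<Rightarrow>
     'a ^ 'm \<Rightarrow> 'a ^ 'm \<Rightarrow> 'a ^ 'm \<Rightarrow> 'a ^ 'm" where
  "gt_page_minibatch V f b S x x' y = (\<chi> i. y $ i + (1 / real b) *\<^sub>R
     (\<Sum>r<b. grad V (f i (S (i, r))) (x' $ i) - grad V (f i (S (i, r))) (x $ i)))"

text \<open>
  \<open>S (i, r)\<close> is the r-th index drawn by node i (with replacement, independently across nodes and
  draws). The coin is shared by all nodes, since the whole stack y is either refreshed or not.
\<close>

definition gt_page_step ::
    "'a::real_inner set \<Rightarrow> nat \<Rightarrow> ('m::finite \<Rightarrow> nat \<Rightarrow> 'a \<Rightarrow> real) \<Rightarrow> nat \<Rightarrow> real \<Rightarrow> real \<Rightarrow>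
     real ^ 'm ^ 'm \<Rightarrow> ('a, 'm) gt_state \<Rightarrow> ('a, 'm) gt_state pmf" where
  "gt_page_step V n f b p \<eta> Wk = (\<lambda>(x, y, v).
     do {
       let x' = kron_apply (mat 1 - Wk) x - \<eta> *\<^sub>R v;
       S \<leftarrow> Pi_pmf (UNIV \<times> {..<b}) 0 (\<lambda>_. pmf_of_set {1..n});
       c \<leftarrow> bernoulli_pmf p;
       let y' = (if c then stacked_grad V n f x' else gt_page_minibatch V f b S x x' y);
       return_pmf (x', y', kron_apply (mat 1 - Wk) v + y' - y)
     })"

text \<open>
  \<open>gt_page_run ... N\<close> is the law of the trajectory of states 0, ..., N; entries after N are padding
  equal to the initial state.
\<close>

primrec gt_page_run ::
    "'a::real_inner set \<Rightarrow> nat \<Rightarrow> ('m::finite \<Rightarrow> nat \<Rightarrow> 'a \<Rightarrow> real) \<Rightarrow> nat \<Rightarrow> real \<Rightarrow> real \<Rightarrow>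
     (nat \<Rightarrow> real ^ 'm ^ 'm) \<Rightarrow> 'a \<Rightarrow> nat \<Rightarrow> (nat \<Rightarrow> ('a, 'm) gt_state) pmf" where
  "gt_page_run V n f b p \<eta> W x0 0 = return_pmf (\<lambda>_. gt_page_init V n f x0)"
| "gt_page_run V n f b p \<eta> W x0 (Suc k) =
     do {
       s \<leftarrow> gt_page_run V n f b p \<eta> W x0 k;
       t \<leftarrow> gt_page_step V n f b p \<eta> (W k) (s k);
       return_pmf (s(Suc k := t))
     }"

definition gt_page_output ::
    "'a::real_inner set \<Rightarrow> nat \<Rightarrow> ('m::finite \<Rightarrow> nat \<Rightarrow> 'a \<Rightarrow> real) \<Rightarrow> nat \<Rightarrow> real \<Rightarrow> real \<Rightarrow>
     (nat \<Rightarrow> real ^ 'm ^ 'm) \<Rightarrow> 'a \<Rightarrow> nat \<Rightarrow> 'a pmf" where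
  "gt_page_output V n f b p \<eta> W x0 N =
     do {
       s \<leftarrow> gt_page_run V n f b p \<eta> W x0 N;
       k \<leftarrow> pmf_of_set {..<N};
       return_pmf (node_avg (fst (s k)))
     }"

end

theory Submission
  imports Defs
begin

text \<open>
  The average of the node variables performs an inexact gradient descent. Gossip preserves
  averages, so \<open>node_avg x\<close> moves by \<open>- \<eta> *\<^sub>R node_avg v\<close>, and \<open>v\<close> is built so that its average
  always equals that of the gradient estimator \<open>y\<close>. The direction thus differs from the gradient of the
  objective (up to the number of nodes) for two reasons: \<open>y\<close> is not the stack of gradients at \<open>x\<close>, and
  the blocks of \<open>x\<close> are not equal (lemma \<open>obj_descent\<close>).

  Three error quantities have to be controlled. The estimation error of \<open>y\<close> is reset with
  probability \<open>p\<close> and otherwise grows by the variance of one minibatch, which average smoothness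
  bounds by the squared displacement of \<open>x\<close> (lemmas \<open>minibatch_variance\<close> and \<open>estimator_step\<close>).
  The consensus errors of \<open>x\<close> and of \<open>v\<close> are contracted by gossip, and fed by \<open>\<eta> *\<^sub>R v\<close> and by the
  increment of \<open>y\<close>, respectively (lemma \<open>deviation_gossip_step\<close>). The displacement of \<open>x\<close> in turn is
  bounded by the consensus errors and the length of the step of the average (lemma \<open>displacement_le\<close>).

  A suitable combination of the objective and the three errors is a Lyapunov function: its
  expectation decreases in every step by at least \<open>\<eta> / (2 * m)\<close> times the squared norm of the gradient, where
  \<open>m\<close> is the number of nodes (lemma \<open>potential_drift\<close>). Since all three errors vanish
  initially, the sum over \<open>N\<close> steps of the expected squared gradient norms is at most
  \<open>2 * m / \<eta>\<close> times the initial gap of the objective (lemma \<open>expected_gradient_output\<close>). The step size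
  is of order \<open>1 / (chi ^ 3 * L * (1 + s))\<close>, with \<open>s\<close> the square root in the bound, which gives the
  stated number of iterations.
\<close>

section \<open>Gradients relative to a subspace\<close>

text \<open>
  The gradient is a definite description, which carries information only where it exists; this
  predicate records existence at every point of the subspace.
\<close>

definition has_grads :: "'a::real_inner set \<Rightarrow> ('a \<Rightarrow> real) \<Rightarrow> bool" where
  "has_grads V f \<longleftrightarrow>
     (\<forall>x\<in>V. grad V f x \<in> V \<and> (f has_derivative (\<lambda>h. grad V f x \<bullet> h)) (at x within V))"

lemma has_gradsD:
  assumes "has_grads V f" "x \<in> V"
  shows "grad V f x \<in> V" "(f has_derivative (\<lambda>h. grad V f x \<bullet> h)) (at x within V)"
  using assms by (auto simp: has_grads_def)

lemma has_gradsI: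
  assumes "subspace V"
    and "\<And>x. x \<in> V \<Longrightarrow> \<exists>g\<in>V. (f has_derivative (\<lambda>h. g \<bullet> h)) (at x within V)"
  shows "has_grads V f"
  unfolding has_grads_def
proof
  fix x assume x: "x \<in> V"
  then obtain g where g: "g \<in> V" "(f has_derivative (\<lambda>h. g \<bullet> h)) (at x within V)"
    using assms(2) by blast
  then have "grad V f x = g" using grad_eqI[OF assms(1) x] by blast
  then show "grad V f x \<in> V \<and> (f has_derivative (\<lambda>h. grad V f x \<bullet> h)) (at x within V)"
    using g by simp
qed

lemma
  assumes V: "subspace V" and f: "\<And>j. j \<in> J \<Longrightarrow> has_grads V (f j)"
  shows has_grads_sum_divide: "has_grads V (\<lambda>u. (\<Sum>j\<in>J. f j u) / c)"
    and grad_sum_divide: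
      "x \<in> V \<Longrightarrow> grad V (\<lambda>u. (\<Sum>j\<in>J. f j u) / c) x = (\<Sum>j\<in>J. grad V (f j) x) /\<^sub>R c"
proof -
  have in_V: "(\<Sum>j\<in>J. grad V (f j) x) /\<^sub>R c \<in> V" if "x \<in> V" for x
    using that V f by (intro subspace_scale subspace_sum) (auto dest: has_gradsD)
  have der: "((\<lambda>u. (\<Sum>j\<in>J. f j u) / c) has_derivative (\<lambda>h. ((\<Sum>j\<in>J. grad V (f j) x) /\<^sub>R c) \<bullet> h))
      (at x within V)" if "x \<in> V" for x
  proof -
    have "((\<lambda>u. (\<Sum>j\<in>J. f j u)) has_derivative (\<lambda>h. \<Sum>j\<in>J. grad V (f j) x \<bullet> h)) (at x within V)"
      using that f by (intro has_derivative_sum) (auto dest: has_gradsD)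
    from has_derivative_mult_left[OF this, of "inverse c"]
    show ?thesis by (simp add: inner_sum_left divide_inverse mult.commute)
  qed
  show "has_grads V (\<lambda>u. (\<Sum>j\<in>J. f j u) / c)"
    using in_V der by (intro has_gradsI[OF V]) blast
  show "grad V (\<lambda>u. (\<Sum>j\<in>J. f j u) / c) x = (\<Sum>j\<in>J. grad V (f j) x) /\<^sub>R c" if "x \<in> V"
    using that by (intro grad_eqI V in_V der)
qed

lemma coord_sum: "coord (\<Sum>j\<in>J. g j) i = (\<Sum>j\<in>J. coord (g j) i)"
  by (induction J rule: infinite_finite_induct) auto

lemma subspace_Rd: "subspace (Rd d)"
  by (auto simp: subspace_def Rd_def)

definition unit_fseq :: "nat \<Rightarrow> fseq" where
  "unit_fseq i = Abs_fseq (\<lambda>j. if j = i then 1 else 0)"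

lemma coord_unit_fseq: "coord (unit_fseq i) j = (if j = i then 1 else 0)"
  by (simp add: unit_fseq_def coord_Abs)

lemma inner_unit_fseq: "unit_fseq i \<bullet> h = coord h i"
  by (subst inner_fseq_superset[of "{i}"]) (auto simp: coord_unit_fseq)

lemma Rd_expansion:
  assumes "h \<in> Rd d"
  shows "h = (\<Sum>i<d. coord h i *\<^sub>R unit_fseq i)"
  using assms by (auto simp: fseq_eq_iff coord_sum coord_unit_fseq Rd_def if_distrib cong: if_cong)

text \<open>
  The derivative on \<open>Rd d\<close> is represented by a vector of \<open>Rd d\<close>, built from its values on the
  unit vectors. Replacing the derivative by this inner product changes it only off \<open>Rd d\<close>,
  where a derivative within \<open>Rd d\<close> is unconstrained.
\<close>

lemma has_grads_Rd:
  assumes "f differentiable_on Rd d"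
  shows "has_grads (Rd d) f"
proof (rule has_gradsI[OF subspace_Rd])
  fix x assume x: "x \<in> Rd d"
  then obtain D where D: "(f has_derivative D) (at x within Rd d)"
    using assms by (auto simp: differentiable_on_def differentiable_def)
  then interpret D: bounded_linear D by (rule has_derivative_bounded_linear)
  define g where "g = (\<Sum>i<d. D (unit_fseq i) *\<^sub>R unit_fseq i)"
  have g: "g \<in> Rd d"
    by (auto simp: g_def Rd_def coord_sum coord_unit_fseq intro!: sum.neutral)
  have gD: "g \<bullet> h = D h" if "h \<in> Rd d" for h
  proof -
    have "D h = (\<Sum>i<d. coord h i * D (unit_fseq i))"
      by (subst Rd_expansion[OF that]) (simp add: D.sum D.scaleR)
    then show ?thesis
      by (simp add: g_def inner_sum_left inner_unit_fseq mult.commute)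
  qed
  have "(f has_derivative (\<lambda>h. g \<bullet> h)) (at x within Rd d)"
    unfolding has_derivative_within
  proof
    let ?q = "\<lambda>D y. (1 / norm (y - x)) *\<^sub>R (f y - (f x + D (y - x)))"
    show "(?q (\<lambda>h. g \<bullet> h) \<longlongrightarrow> 0) (at x within Rd d)"
    proof (rule Lim_transform_eventually)
      show "(?q D \<longlongrightarrow> 0) (at x within Rd d)"
        using D unfolding has_derivative_within by blast
      show "\<forall>\<^sub>F y in at x within Rd d. ?q D y = ?q (\<lambda>h. g \<bullet> h) y"
        using x by (auto simp: eventually_at_filter gD subspace_diff[OF subspace_Rd])
    qed
  qed (rule bounded_linear_inner_right)
  with g show "\<exists>g\<in>Rd d. (f has_derivative (\<lambda>h. g \<bullet> h)) (at x within Rd d)" by blast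
qed

text \<open>
  Along the segment from \<open>x\<close> to \<open>x + h\<close> the difference of the two sides has derivative
  \<open>(grad V f (x + t *\<^sub>R h) - grad V f x) \<bullet> h - L * t * (norm h)\<^sup>2\<close>, which is nonpositive.
\<close>

lemma descent_lemma:
  assumes V: "subspace V" and f: "has_grads V f" and L: "L_smooth V f L" and "x \<in> V" "h \<in> V"
  shows "f (x + h) \<le> f x + grad V f x \<bullet> h + L / 2 * (norm h)\<^sup>2"
proof -
  have in_V: "x + t *\<^sub>R h \<in> V" for t
    using assms by (auto intro: subspace_add subspace_scale)
  define \<phi> where "\<phi> t = f (x + t *\<^sub>R h) - t * (grad V f x \<bullet> h) - L / 2 * (norm h)\<^sup>2 * t\<^sup>2" for t
  have der: "(\<phi> has_real_derivative (grad V f (x + t *\<^sub>R h) - grad V f x) \<bullet> h - L * t * (norm h)\<^sup>2) (at t)"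
    for t
  proof -
    have l: "((\<lambda>t. x + t *\<^sub>R h) has_derivative (\<lambda>s. s *\<^sub>R h)) (at t)"
      by (auto intro!: derivative_eq_intros)
    have "(f has_derivative (\<lambda>k. grad V f (x + t *\<^sub>R h) \<bullet> k)) (at (x + t *\<^sub>R h) within range (\<lambda>t. x + t *\<^sub>R h))"
      using in_V by (intro has_derivative_subset[OF has_gradsD(2)[OF f in_V]]) auto
    from has_derivative_in_compose[OF l this]
    have "((\<lambda>t. f (x + t *\<^sub>R h)) has_real_derivative (grad V f (x + t *\<^sub>R h) \<bullet> h)) (at t)"
      by (simp add: has_field_derivative_def mult_commute_abs)
    then show ?thesis unfolding \<phi>_def
      by (auto intro!: derivative_eq_intros simp: inner_diff_left algebra_simps)
  qed
  have "\<phi> 1 \<le> \<phi> 0"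
  proof (rule DERIV_nonpos_imp_nonincreasing[of 0 1 \<phi>])
    fix t :: real assume t: "0 \<le> t" "t \<le> 1"
    have "(grad V f (x + t *\<^sub>R h) - grad V f x) \<bullet> h \<le> norm (grad V f (x + t *\<^sub>R h) - grad V f x) * norm h"
      by (rule norm_cauchy_schwarz)
    also have "\<dots> \<le> (L * norm (x + t *\<^sub>R h - x)) * norm h"
      using L in_V[of t] \<open>x \<in> V\<close> unfolding L_smooth_def by (intro mult_right_mono) (blast, simp)
    also have "\<dots> = L * t * (norm h)\<^sup>2"
      using t by (simp add: power2_eq_square)
    finally show "\<exists>y. DERIV \<phi> t :> y \<and> y \<le> 0"
      using der by (intro exI[of _ "(grad V f (x + t *\<^sub>R h) - grad V f x) \<bullet> h - L * t * (norm h)\<^sup>2"]) auto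
  qed simp
  then show ?thesis by (simp add: \<phi>_def)
qed

section \<open>Expectations over finitely supported distributions\<close>

lemma expectation_bind_finite:
  fixes h :: "'b \<Rightarrow> real"
  assumes "finite (set_pmf q)" "\<And>x. x \<in> set_pmf q \<Longrightarrow> finite (set_pmf (g x))"
  shows "measure_pmf.expectation (bind_pmf q g) h =
    measure_pmf.expectation q (\<lambda>x. measure_pmf.expectation (g x) h)"
  using assms by (subst pmf_expectation_bind[of "set_pmf q"])
    (auto simp: integral_measure_pmf[of "set_pmf q"])

lemma expectation_mono_finite:
  fixes g h :: "'b \<Rightarrow> real"
  assumes "finite (set_pmf q)" "\<And>x. x \<in> set_pmf q \<Longrightarrow> g x \<le> h x"
  shows "measure_pmf.expectation q g \<le> measure_pmf.expectation q h"
  using assms by (intro integral_mono_AE integrable_measure_pmf_finite) (auto simp: AE_measure_pmf_iff)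

lemma finite_set_Pi_pmf:
  assumes "finite A" "\<And>k. k \<in> A \<Longrightarrow> finite (set_pmf (q k))"
  shows "finite (set_pmf (Pi_pmf A dflt q))"
  using assms by (simp add: set_Pi_pmf finite_PiE_dflt)

text \<open>
  The variance of a sum of independent centred vectors is the sum of their variances. Centredness
  is expressed against every fixed vector, so no vector-valued integral occurs.
\<close>

lemma expectation_norm_add_sum_Pi_pmf:
  fixes u :: "'k \<Rightarrow> 'b \<Rightarrow> 'a::real_inner"
  assumes "finite A" and fin: "\<And>k. k \<in> A \<Longrightarrow> finite (set_pmf (q k))"
    and centred: "\<And>k c. k \<in> A \<Longrightarrow> measure_pmf.expectation (q k) (\<lambda>j. c \<bullet> u k j) = 0"
  shows "measure_pmf.expectation (Pi_pmf A dflt q) (\<lambda>S. (norm (c + (\<Sum>k\<in>A. u k (S k))))\<^sup>2) =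
    (norm c)\<^sup>2 + (\<Sum>k\<in>A. measure_pmf.expectation (q k) (\<lambda>j. (norm (u k j))\<^sup>2))"
  using assms
proof (induction A arbitrary: c rule: finite_induct)
  case empty
  then show ?case by simp
next
  case (insert a A)
  let ?V = "\<Sum>k\<in>A. measure_pmf.expectation (q k) (\<lambda>j. (norm (u k j))\<^sup>2)"
  have [simp]: "finite (set_pmf (q a))" using insert.prems by auto
  have fA: "finite (set_pmf (Pi_pmf A dflt q))"
    using insert by (intro finite_set_Pi_pmf) auto
  have "measure_pmf.expectation (Pi_pmf (insert a A) dflt q)
      (\<lambda>S. (norm (c + (\<Sum>k\<in>insert a A. u k (S k))))\<^sup>2) =
    measure_pmf.expectation (q a) (\<lambda>j. measure_pmf.expectation (Pi_pmf A dflt q)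
      (\<lambda>S. (norm ((c + u a j) + (\<Sum>k\<in>A. u k (S k))))\<^sup>2))"
  proof -
    have "(\<Sum>k\<in>A. u k ((S(a := j)) k)) = (\<Sum>k\<in>A. u k (S k))" for S j
      using insert.hyps by (intro sum.cong) auto
    then show ?thesis
      using insert.hyps fA
      by (subst Pi_pmf_insert') (auto simp: expectation_bind_finite add.assoc)
  qed
  also have "\<dots> = measure_pmf.expectation (q a) (\<lambda>j. (norm (c + u a j))\<^sup>2 + ?V)"
    by (subst insert.IH) (use insert.prems in auto)
  also have "\<dots> = measure_pmf.expectation (q a)
      (\<lambda>j. (norm c)\<^sup>2 + 2 * (c \<bullet> u a j) + (norm (u a j))\<^sup>2 + ?V)"
    by (simp add: power2_norm_eq_inner inner_add_left inner_add_right inner_commute algebra_simps)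
  also have "\<dots> = (norm c)\<^sup>2 + measure_pmf.expectation (q a) (\<lambda>j. (norm (u a j))\<^sup>2) + ?V"
    using insert.prems(2)[of a c] by (simp add: integrable_measure_pmf_finite)
  finally show ?case
    using insert.hyps by simp
qed

section \<open>Stacked vectors and gossip\<close>

definition deviation :: "'a::real_vector ^ 'm::finite \<Rightarrow> 'a ^ 'm" where
  "deviation x = x - (\<chi> i. node_avg x)"

lemma norm_vec_squared:
  fixes x :: "'a::real_inner ^ 'm::finite"
  shows "(norm x)\<^sup>2 = (\<Sum>i\<in>UNIV. (norm (x $ i))\<^sup>2)"
  by (simp add: power2_norm_eq_inner inner_vec_def)

lemma node_avg_add: "node_avg (x + y) = node_avg x + node_avg y"
  and node_avg_diff: "node_avg (x - y) = node_avg x - node_avg y"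
  and node_avg_scaleR: "node_avg (c *\<^sub>R x) = c *\<^sub>R node_avg x"
  and node_avg_const: "node_avg (\<chi> i. a) = a"
  by (simp_all add: node_avg_def sum.distrib sum_subtractf scaleR_add_right scaleR_diff_right
      scaleR_sum_right mult.commute sum_constant_scaleR)

lemma deviation_add: "deviation (x + y) = deviation x + deviation y"
  and deviation_diff: "deviation (x - y) = deviation x - deviation y"
  and deviation_scaleR: "deviation (c *\<^sub>R x) = c *\<^sub>R deviation x"
  and deviation_const: "deviation (\<chi> i. a) = 0"
  by (simp_all add: deviation_def vec_eq_iff node_avg_add node_avg_diff node_avg_scaleR
      node_avg_const algebra_simps)

lemma sum_deviation: "(\<Sum>i\<in>UNIV. deviation x $ i) = 0"
  by (simp add: deviation_def sum_subtractf node_avg_def sum_constant_scaleR)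

text \<open>Consensus vectors are orthogonal to vectors whose blocks sum to zero.\<close>

lemma norm_squared_avg_deviation:
  fixes x :: "'a::real_inner ^ 'm::finite"
  shows "(norm x)\<^sup>2 = real CARD('m) * (norm (node_avg x))\<^sup>2 + (norm (deviation x))\<^sup>2"
proof -
  define c :: "'a ^ 'm" where "c = (\<chi> i. node_avg x)"
  have "c \<bullet> deviation x = node_avg x \<bullet> (\<Sum>i\<in>UNIV. deviation x $ i)"
    by (simp add: inner_vec_def c_def inner_sum_right)
  then have orth: "c \<bullet> deviation x = 0" by (simp add: sum_deviation)
  have "x = c + deviation x" by (simp add: c_def deviation_def)
  then have "(norm x)\<^sup>2 = (norm (c + deviation x))\<^sup>2" by simp
  also have "\<dots> = (norm c)\<^sup>2 + (norm (deviation x))\<^sup>2"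
    using orth by (simp add: power2_norm_eq_inner inner_add_left inner_add_right inner_commute)
  also have "(norm c)\<^sup>2 = real CARD('m) * (norm (node_avg x))\<^sup>2"
    by (simp add: norm_vec_squared c_def)
  finally show ?thesis .
qed

lemma norm_deviation_le:
  fixes x :: "'a::real_inner ^ 'm::finite"
  shows "(norm (deviation x))\<^sup>2 \<le> (norm x)\<^sup>2"
  and norm_node_avg_le: "real CARD('m) * (norm (node_avg x))\<^sup>2 \<le> (norm x)\<^sup>2"
  by (simp_all add: norm_squared_avg_deviation[of x])

lemma norm_add_squared_young:
  fixes a c :: "'a::real_inner"
  assumes "\<alpha> > 0"
  shows "(norm (a + c))\<^sup>2 \<le> (1 + \<alpha>) * (norm a)\<^sup>2 + (1 + 1 / \<alpha>) * (norm c)\<^sup>2"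
proof -
  have "0 \<le> (norm (\<alpha> *\<^sub>R a - c))\<^sup>2 / \<alpha>" using assms by simp
  also have "\<dots> = \<alpha> * (norm a)\<^sup>2 + (norm c)\<^sup>2 / \<alpha> - 2 * (a \<bullet> c)"
    using assms by (simp add: power2_norm_eq_inner inner_diff_left inner_diff_right inner_commute
        field_simps)
  finally show ?thesis
    by (simp add: power2_norm_eq_inner inner_add_left inner_add_right inner_commute algebra_simps)
qed

lemma norm_add_squared_le2:
  fixes a c :: "'a::real_inner"
  shows "(norm (a + c))\<^sup>2 \<le> 2 * (norm a)\<^sup>2 + 2 * (norm c)\<^sup>2"
  using norm_add_squared_young[of 1 a c] by simp

lemma kron_apply_diff: "kron_apply A (x - y) = kron_apply A x - kron_apply A y"
  by (simp add: kron_apply_def vec_eq_iff scaleR_diff_right sum_subtractf)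

lemma kron_apply_mat_minus: "kron_apply (mat 1 - A) x = x - kron_apply A x"
  by (simp add: kron_apply_def vec_eq_iff mat_def scaleR_diff_left sum_subtractf
      if_distrib[of "\<lambda>c. c *\<^sub>R _"] cong: if_cong)

lemma kron_apply_in_subspace:
  assumes "subspace V" "\<And>i. x $ i \<in> V"
  shows "kron_apply A x $ i \<in> V"
  using assms by (auto simp: kron_apply_def intro!: subspace_sum subspace_scale)

lemma node_avg_in_subspace:
  assumes "subspace V" "\<And>i. x $ i \<in> V"
  shows "node_avg x \<in> V"
  using assms by (auto simp: node_avg_def intro!: subspace_sum subspace_scale)

locale gossip_matrices =
  fixes V :: "'a::real_inner set" and E :: "nat \<Rightarrow> ('m::finite \<times> 'm) set"
    and W :: "nat \<Rightarrow> real ^ 'm ^ 'm" and chi :: real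
  assumes V: "subspace V" and gossip: "gossip V E W chi" and chi: "chi \<ge> 1"
begin

lemma kron_const: "kron_apply (W k) (\<chi> i. a) = 0"
proof -
  have "W k *v (\<chi> i. 1) = 0"
  proof -
    have "(\<chi> i. 1) \<in> {a :: real ^ 'm. \<forall>i j. a $ i = a $ j}" by simp
    then show ?thesis using gossip[unfolded gossip_def, THEN spec, of k] by blast
  qed
  then have "(\<Sum>j\<in>UNIV. W k $ i $ j) = 0" for i
    by (simp add: matrix_vector_mult_def vec_eq_iff)
  then show ?thesis
    by (simp add: kron_apply_def vec_eq_iff flip: scaleR_sum_left)
qed

lemma node_avg_kron: "node_avg (kron_apply (W k) x) = 0"
proof -
  have "(\<Sum>i\<in>UNIV. W k $ i $ j) = 0" for j
  proof -
    have "W k *v axis j 1 \<in> range (\<lambda>a. W k *v a)" by blast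
    then have "(\<Sum>i\<in>UNIV. (W k *v axis j 1) $ i) = 0"
      using gossip[unfolded gossip_def, THEN spec, of k] by blast
    then show ?thesis by (simp add: matrix_vector_mult_basis column_def)
  qed
  then have "(\<Sum>j\<in>UNIV. (\<Sum>i\<in>UNIV. (W k $ i $ j) *\<^sub>R (x $ j))) = 0"
    by (simp flip: scaleR_sum_left)
  then show ?thesis
    by (subst (asm) sum.swap) (simp add: node_avg_def kron_apply_def)
qed

lemma kron_deviation: "kron_apply (W k) (deviation x) = kron_apply (W k) x"
  by (simp add: deviation_def kron_apply_diff kron_const)

lemma deviation_kron: "deviation (kron_apply (W k) x) = kron_apply (W k) x"
  by (simp add: deviation_def node_avg_kron vec_eq_iff)

lemma kron_minus_deviation_contracts:
  assumes "\<And>i. x $ i \<in> V"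
  shows "(norm (deviation x - kron_apply (W k) x))\<^sup>2 \<le> (1 - 1 / chi) * (norm (deviation x))\<^sup>2"
proof -
  have "deviation x $ i \<in> V" for i
    using assms V by (simp add: deviation_def node_avg_in_subspace subspace_diff)
  then have "(norm (kron_apply (W k) (deviation x) - deviation x))\<^sup>2 \<le> (1 - 1 / chi) * (norm (deviation x))\<^sup>2"
    using gossip[unfolded gossip_def, THEN spec, of k] sum_deviation[of x] by blast
  then show ?thesis by (simp add: kron_deviation norm_minus_commute)
qed

lemma norm_kron_le:
  assumes "\<And>i. x $ i \<in> V"
  shows "(norm (kron_apply (W k) x))\<^sup>2 \<le> 4 * (norm (deviation x))\<^sup>2"
proof -
  have "(1 - 1 / chi) * (norm (deviation x))\<^sup>2 \<le> (norm (deviation x))\<^sup>2"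
    using chi by (intro mult_left_le_one_le) auto
  with kron_minus_deviation_contracts[OF assms, of k]
  have "(norm (deviation x - kron_apply (W k) x))\<^sup>2 \<le> (norm (deviation x))\<^sup>2" by linarith
  moreover have "(norm (kron_apply (W k) x))\<^sup>2
      \<le> 2 * (norm (deviation x))\<^sup>2 + 2 * (norm (deviation x - kron_apply (W k) x))\<^sup>2"
    using norm_add_squared_le2[of "deviation x" "kron_apply (W k) x - deviation x"]
    by (simp add: norm_minus_commute)
  ultimately show ?thesis by linarith
qed

text \<open>
  One gossip round with an input \<open>z\<close>. Young's inequality with weight \<open>1 / (2 * chi)\<close> gives up half
  of the contraction \<open>1 / chi\<close> and multiplies the input by at most \<open>1 + 2 * chi \<le> 3 * chi\<close>.
\<close>

lemma deviation_gossip_step: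
  assumes "\<And>i. x $ i \<in> V"
  shows "(norm (deviation (kron_apply (mat 1 - W k) x + z)))\<^sup>2
    \<le> (1 - 1 / (2 * chi)) * (norm (deviation x))\<^sup>2 + 3 * chi * (norm (deviation z))\<^sup>2"
proof -
  let ?c = "deviation x - kron_apply (W k) x"
  have "(norm (deviation (kron_apply (mat 1 - W k) x + z)))\<^sup>2 = (norm (?c + deviation z))\<^sup>2"
    by (simp add: kron_apply_mat_minus deviation_add deviation_diff deviation_kron)
  also have "\<dots> \<le> (1 + 1 / (2 * chi)) * (norm ?c)\<^sup>2 + (1 + 2 * chi) * (norm (deviation z))\<^sup>2"
    using norm_add_squared_young[of "1 / (2 * chi)" ?c "deviation z"] chi by simp
  also have "\<dots> \<le> (1 + 1 / (2 * chi)) * ((1 - 1 / chi) * (norm (deviation x))\<^sup>2)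
      + 3 * chi * (norm (deviation z))\<^sup>2"
    using chi kron_minus_deviation_contracts[OF assms]
    by (intro add_mono mult_left_mono mult_right_mono) auto
  also have "(1 + 1 / (2 * chi)) * ((1 - 1 / chi) * (norm (deviation x))\<^sup>2)
      \<le> (1 - 1 / (2 * chi)) * (norm (deviation x))\<^sup>2"
  proof -
    have "(1 + 1 / (2 * chi)) * (1 - 1 / chi) = 1 - 1 / (2 * chi) - 1 / (2 * chi * chi)"
      using chi by (simp add: field_simps)
    also have "\<dots> \<le> 1 - 1 / (2 * chi)" using chi by simp
    finally show ?thesis by (metis mult.assoc mult_right_mono zero_le_power2)
  qed
  finally show ?thesis by simp
qed

end

section \<open>One step of the algorithm\<close>

text \<open>
  The subspace is kept abstract: all that the analysis needs of it is that the summands have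
  gradients. The last assumption restricts the step size; the factor \<open>chi ^ 4\<close> comes from
  the feedback loop between the consensus errors of \<open>x\<close> and \<open>v\<close>, each of which is amplified by
  \<open>chi\<^sup>2\<close>. The bracket combines the smoothness constant with the variance that the minibatches
  accumulate during the \<open>1 / p\<close> steps expected between two refreshes.
\<close>

locale gt_page = gossip_matrices V E W chi
  for V :: "'a::real_inner set" and E :: "nat \<Rightarrow> ('m::finite \<times> 'm) set"
    and W :: "nat \<Rightarrow> real ^ 'm ^ 'm" and chi :: real +
  fixes n :: nat and f :: "'m \<Rightarrow> nat \<Rightarrow> 'a \<Rightarrow> real" and L Lhat :: real
    and b :: nat and p \<eta> :: real
  assumes f: "\<And>i j. j \<in> {1..n} \<Longrightarrow> has_grads V (f i j)"
    and smooth: "\<And>i. L_smooth V (node_obj n f i) L"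
    and average: "\<And>i. average_smooth V n (f i) Lhat"
    and n: "n \<ge> 1" and L: "L > 0" and b: "b \<ge> 1" and p: "0 < p" "p \<le> 1" and \<eta>: "\<eta> > 0"
    and step_size: "1872 * chi ^ 4 * \<eta>\<^sup>2 * (L\<^sup>2 + (1 - p) * Lhat\<^sup>2 / (real b * p)) \<le> 1"
begin

abbreviation F :: "'a \<Rightarrow> real" where "F \<equiv> obj n f"
abbreviation G :: "'a ^ 'm \<Rightarrow> 'a ^ 'm" where "G \<equiv> stacked_grad V n f"

lemma node_obj_sum: "node_obj n f i = (\<lambda>u. (\<Sum>j\<in>{1..n}. f i j u) / real n)"
  by (simp add: node_obj_def fun_eq_iff)

lemma obj_sum: "F = (\<lambda>u. (\<Sum>i\<in>UNIV. node_obj n f i u) / 1)"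
  by (simp add: obj_def fun_eq_iff)

lemma has_grads_node_obj: "has_grads V (node_obj n f i)"
  unfolding node_obj_sum by (intro has_grads_sum_divide V f)

lemma grad_node_obj:
  "u \<in> V \<Longrightarrow> grad V (node_obj n f i) u = (\<Sum>j\<in>{1..n}. grad V (f i j) u) /\<^sub>R real n"
  unfolding node_obj_sum by (intro grad_sum_divide V f)

lemma has_grads_obj: "has_grads V F"
  unfolding obj_sum by (intro has_grads_sum_divide V has_grads_node_obj)

lemma grad_obj: "u \<in> V \<Longrightarrow> grad V F u = real CARD('m) *\<^sub>R node_avg (G (\<chi> i. u))"
  unfolding obj_sum
  by (subst grad_sum_divide[OF V has_grads_node_obj]) (auto simp: node_avg_def stacked_grad_def)

lemma stacked_grad_in_V: "(\<And>i. x $ i \<in> V) \<Longrightarrow> G x $ i \<in> V"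
  using has_gradsD(1)[OF has_grads_node_obj] by (simp add: stacked_grad_def)

lemma stacked_grad_lipschitz:
  assumes "\<And>i. x $ i \<in> V" "\<And>i. z $ i \<in> V"
  shows "(norm (G x - G z))\<^sup>2 \<le> L\<^sup>2 * (norm (x - z))\<^sup>2"
proof -
  have "(norm ((G x - G z) $ i))\<^sup>2 \<le> L\<^sup>2 * (norm ((x - z) $ i))\<^sup>2" for i
  proof -
    have "norm ((G x - G z) $ i) \<le> L * norm ((x - z) $ i)"
      using smooth[of i] assms by (simp add: L_smooth_def stacked_grad_def)
    then have "(norm ((G x - G z) $ i))\<^sup>2 \<le> (L * norm ((x - z) $ i))\<^sup>2"
      by (intro power_mono) auto
    then show ?thesis by (simp add: power_mult_distrib)
  qed
  then show ?thesis
    by (simp add: norm_vec_squared sum_distrib_left sum_mono del: vector_minus_component)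
qed

lemma obj_smooth: "L_smooth V F (real CARD('m) * L)"
  unfolding L_smooth_def
proof (intro ballI)
  fix u v assume uv: "u \<in> V" "v \<in> V"
  have "norm (grad V F u - grad V F v)
      = norm (\<Sum>i\<in>UNIV. grad V (node_obj n f i) u - grad V (node_obj n f i) v)"
    using uv by (simp add: grad_obj node_avg_def stacked_grad_def sum_subtractf)
  also have "\<dots> \<le> (\<Sum>i\<in>(UNIV :: 'm set). L * norm (u - v))"
    using uv smooth by (intro sum_norm_le) (simp add: L_smooth_def)
  finally show "norm (grad V F u - grad V F v) \<le> real CARD('m) * L * norm (u - v)" by simp
qed

text \<open>
  The averages evolve by \<open>u \<mapsto> u - \<eta> *\<^sub>R node_avg y\<close>, so the descent lemma applies with the
  direction \<open>node_avg y\<close> in place of the gradient; the inner product is split by polarisation, and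
  the error of the direction consists of the estimation error of \<open>y\<close> and the consensus error.
\<close>

lemma obj_descent:
  fixes x y :: "'a ^ 'm"
  assumes x: "\<And>i. x $ i \<in> V" and y: "\<And>i. y $ i \<in> V"
  defines "u \<equiv> node_avg x"
  shows "F (u - \<eta> *\<^sub>R node_avg y) \<le> F u - \<eta> / (2 * real CARD('m)) * (norm (grad V F u))\<^sup>2
    - real CARD('m) * (\<eta> / 2 - L * \<eta>\<^sup>2 / 2) * (norm (node_avg y))\<^sup>2
    + \<eta> * ((norm (y - G x))\<^sup>2 + L\<^sup>2 * (norm (deviation x))\<^sup>2)"
proof -
  have u: "u \<in> V" using x V by (simp add: u_def node_avg_in_subspace)
  define w where "w = node_avg y"
  have w: "w \<in> V" using y V by (simp add: w_def node_avg_in_subspace)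
  define a where "a = node_avg (G (\<chi> i. u))"
  have a: "grad V F u = real CARD('m) *\<^sub>R a" using grad_obj[OF u] by (simp add: a_def)
  have "real CARD('m) * (norm (w - a))\<^sup>2 \<le> (norm (y - G (\<chi> i. u)))\<^sup>2"
    using norm_node_avg_le[of "y - G (\<chi> i. u)"] by (simp add: w_def a_def node_avg_diff)
  also have "\<dots> \<le> 2 * (norm (y - G x))\<^sup>2 + 2 * (norm (G x - G (\<chi> i. u)))\<^sup>2"
    using norm_add_squared_le2[of "y - G x" "G x - G (\<chi> i. u)"] by simp
  also have "\<dots> \<le> 2 * (norm (y - G x))\<^sup>2 + 2 * (L\<^sup>2 * (norm (deviation x))\<^sup>2)"
    using stacked_grad_lipschitz[of x "\<chi> i. u"] x u by (simp add: deviation_def u_def)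
  finally have err: "real CARD('m) * (norm (w - a))\<^sup>2 \<le> 2 * ((norm (y - G x))\<^sup>2 + L\<^sup>2 * (norm (deviation x))\<^sup>2)"
    by simp
  have "F (u + - (\<eta> *\<^sub>R w)) \<le> F u + grad V F u \<bullet> (- (\<eta> *\<^sub>R w)) + real CARD('m) * L / 2 * (norm (- (\<eta> *\<^sub>R w)))\<^sup>2"
    using u w V by (intro descent_lemma has_grads_obj obj_smooth) (auto intro: subspace_neg subspace_scale)
  also have "\<dots> = F u - \<eta> * real CARD('m) * (a \<bullet> w) + real CARD('m) * L / 2 * \<eta>\<^sup>2 * (norm w)\<^sup>2"
    by (simp add: a power_mult_distrib algebra_simps)
  also have "a \<bullet> w = ((norm a)\<^sup>2 + (norm w)\<^sup>2 - (norm (w - a))\<^sup>2) / 2"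
    by (simp add: power2_norm_eq_inner inner_diff_left inner_diff_right inner_commute)
  also have "F u - \<eta> * real CARD('m) * (((norm a)\<^sup>2 + (norm w)\<^sup>2 - (norm (w - a))\<^sup>2) / 2)
      + real CARD('m) * L / 2 * \<eta>\<^sup>2 * (norm w)\<^sup>2
    = F u - \<eta> / (2 * real CARD('m)) * (norm (grad V F u))\<^sup>2 - real CARD('m) * (\<eta> / 2 - L * \<eta>\<^sup>2 / 2) * (norm w)\<^sup>2
      + \<eta> / 2 * (real CARD('m) * (norm (w - a))\<^sup>2)"
    by (simp add: a power_mult_distrib power2_eq_square field_simps)
  also have "\<dots> \<le> F u - \<eta> / (2 * real CARD('m)) * (norm (grad V F u))\<^sup>2 - real CARD('m) * (\<eta> / 2 - L * \<eta>\<^sup>2 / 2) * (norm w)\<^sup>2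
      + \<eta> * ((norm (y - G x))\<^sup>2 + L\<^sup>2 * (norm (deviation x))\<^sup>2)"
    using mult_left_mono[OF err, of "\<eta> / 2"] \<eta> by simp
  finally show ?thesis by (simp add: w_def)
qed

definition batch :: "('m \<times> nat \<Rightarrow> nat) pmf" where
  "batch = Pi_pmf (UNIV \<times> {..<b}) 0 (\<lambda>_. pmf_of_set {1..n})"

lemma finite_set_batch: "finite (set_pmf batch)"
  using n unfolding batch_def by (intro finite_set_Pi_pmf) auto

lemma batch_range: "S \<in> set_pmf batch \<Longrightarrow> r < b \<Longrightarrow> S (i, r) \<in> {1..n}"
  using n by (fastforce simp: batch_def set_Pi_pmf PiE_dflt_def)

text \<open>
  The centred minibatch noise is a sum of independent centred vectors, one for each node and draw,
  and the variance of a draw is at most its mean square, which average smoothness bounds.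
\<close>

lemma minibatch_variance:
  fixes x x' y c :: "'a ^ 'm"
  assumes x: "\<And>i. x $ i \<in> V" and x': "\<And>i. x' $ i \<in> V"
  shows "measure_pmf.expectation batch
      (\<lambda>S. (norm (c + (gt_page_minibatch V f b S x x' y - y - (G x' - G x))))\<^sup>2)
    \<le> (norm c)\<^sup>2 + Lhat\<^sup>2 / real b * (norm (x' - x))\<^sup>2"
proof -
  define d where "d i j = grad V (f i j) (x' $ i) - grad V (f i j) (x $ i)" for i j
  define e where "e i = (\<Sum>j\<in>{1..n}. d i j) /\<^sub>R real n" for i
  have e: "(G x' - G x) $ i = e i" for i
    using x x' by (simp add: stacked_grad_def grad_node_obj e_def d_def sum_subtractf
        scaleR_diff_right)
  have centred: "(\<Sum>j\<in>{1..n}. c \<bullet> (d i j - e i)) = 0" for i c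
    using n by (simp add: inner_diff_right sum_subtractf e_def flip: inner_sum_right)
  define u :: "'m \<times> nat \<Rightarrow> nat \<Rightarrow> 'a ^ 'm"
    where "u k j = axis (fst k) ((1 / real b) *\<^sub>R (d (fst k) j - e (fst k)))" for k j
  have inner_u: "c \<bullet> u k j = (1 / real b) * ((c $ fst k) \<bullet> (d (fst k) j - e (fst k)))" for c k j
    by (simp add: u_def inner_axis)
  have noise: "gt_page_minibatch V f b S x x' y - y - (G x' - G x)
      = (\<Sum>k\<in>UNIV \<times> {..<b}. u k (S k))" for S
  proof (simp only: vec_eq_iff, intro allI)
    fix i
    have "(\<Sum>k\<in>UNIV \<times> {..<b}. u k (S k)) $ i = (\<Sum>r<b. \<Sum>l\<in>UNIV. u (l, r) (S (l, r)) $ i)"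
      by (simp add: sum.cartesian_product' sum.swap[of _ UNIV])
    also have "\<dots> = (\<Sum>r<b. (1 / real b) *\<^sub>R (d i (S (i, r)) - e i))"
      by (simp add: u_def axis_def if_distrib cong: if_cong)
    also have "\<dots> = (1 / real b) *\<^sub>R (\<Sum>r<b. d i (S (i, r))) - e i"
      using b by (simp add: sum_subtractf scaleR_diff_right scaleR_sum_right[symmetric]
          sum_constant_scaleR)
    also have "\<dots> = (gt_page_minibatch V f b S x x' y - y - (G x' - G x)) $ i"
      by (simp only: vector_minus_component[of _ "G x' - G x"] e)
        (simp add: gt_page_minibatch_def d_def)
    finally show "(gt_page_minibatch V f b S x x' y - y - (G x' - G x)) $ i
      = (\<Sum>k\<in>UNIV \<times> {..<b}. u k (S k)) $ i" by simp
  qed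
  have uniform: "measure_pmf.expectation (pmf_of_set {1..n}) h = (\<Sum>j\<in>{1..n}. h j) / real n"
    for h :: "nat \<Rightarrow> real"
    using n by (subst integral_pmf_of_set) auto
  have "(\<Sum>j\<in>{1..n}. (norm (d i j - e i))\<^sup>2) \<le> (\<Sum>j\<in>{1..n}. (norm (d i j))\<^sup>2)" for i
  proof -
    have "(norm (d i j))\<^sup>2 = (norm (d i j - e i))\<^sup>2 + 2 * (e i \<bullet> (d i j - e i)) + (norm (e i))\<^sup>2" for j
      by (simp add: power2_norm_eq_inner inner_diff_left inner_diff_right inner_commute)
    then have "(\<Sum>j\<in>{1..n}. (norm (d i j))\<^sup>2)
        = (\<Sum>j\<in>{1..n}. (norm (d i j - e i))\<^sup>2) + real n * (norm (e i))\<^sup>2"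
      using centred[of "e i" i] by (simp add: sum.distrib flip: sum_distrib_left)
    then show ?thesis by simp
  qed
  then have var: "(\<Sum>j\<in>{1..n}. (norm (d i j - e i))\<^sup>2) / real n \<le> Lhat\<^sup>2 * (norm (x' $ i - x $ i))\<^sup>2" for i
    using average[of i] x x' n unfolding average_smooth_def d_def
    by (meson divide_right_mono of_nat_0_le_iff order_trans)
  have u_sq: "measure_pmf.expectation (pmf_of_set {1..n}) (\<lambda>j. (norm (u k j))\<^sup>2)
      \<le> (1 / real b)\<^sup>2 * (Lhat\<^sup>2 * (norm (x' $ fst k - x $ fst k))\<^sup>2)" for k
  proof -
    have "(norm (u k j))\<^sup>2 = (1 / real b)\<^sup>2 * (norm (d (fst k) j - e (fst k)))\<^sup>2" for j
      using inner_u[of "u k j" k j] by (simp add: power2_norm_eq_inner) (simp add: u_def power2_eq_square)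
    then have "measure_pmf.expectation (pmf_of_set {1..n}) (\<lambda>j. (norm (u k j))\<^sup>2)
        = (1 / real b)\<^sup>2 * ((\<Sum>j\<in>{1..n}. (norm (d (fst k) j - e (fst k)))\<^sup>2) / real n)"
      by (simp only: uniform) (simp add: sum_distrib_left)
    also have "\<dots> \<le> (1 / real b)\<^sup>2 * (Lhat\<^sup>2 * (norm (x' $ fst k - x $ fst k))\<^sup>2)"
      by (intro mult_left_mono var) auto
    finally show ?thesis .
  qed
  have zero: "measure_pmf.expectation (pmf_of_set {1..n}) (\<lambda>j. c \<bullet> u k j) = 0" for c k
    using centred[of "c $ fst k" "fst k"]
    by (simp only: inner_u uniform mult_zero_right div_0 flip: sum_distrib_left)
  have "measure_pmf.expectation batch
      (\<lambda>S. (norm (c + (gt_page_minibatch V f b S x x' y - y - (G x' - G x))))\<^sup>2)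
    = (norm c)\<^sup>2 + (\<Sum>k\<in>UNIV \<times> {..<b}. measure_pmf.expectation (pmf_of_set {1..n}) (\<lambda>j. (norm (u k j))\<^sup>2))"
    unfolding noise batch_def using n by (intro expectation_norm_add_sum_Pi_pmf zero) auto
  also have "\<dots> \<le> (norm c)\<^sup>2
      + (\<Sum>k\<in>UNIV \<times> {..<b}. (1 / real b)\<^sup>2 * (Lhat\<^sup>2 * (norm (x' $ fst k - x $ fst k))\<^sup>2))"
    by (intro add_left_mono sum_mono u_sq)
  also have "\<dots> = (norm c)\<^sup>2 + (\<Sum>i\<in>UNIV. Lhat\<^sup>2 / real b * (norm (x' $ i - x $ i))\<^sup>2)"
    using b by (simp add: sum.cartesian_product' power2_eq_square)
  also have "\<dots> = (norm c)\<^sup>2 + Lhat\<^sup>2 / real b * (norm (x' - x))\<^sup>2"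
    by (simp add: norm_vec_squared[of "x' - x"] sum_distrib_left)
  finally show ?thesis .
qed


definition M :: real where
  "M = L\<^sup>2 + (1 - p) * Lhat\<^sup>2 / (real b * p)"

text \<open>
  The weights are fixed by what the drift has to absorb: \<open>2 * \<eta> / p\<close> makes the refreshes reduce the
  estimation term by twice what the descent inequality charges for it; \<open>\<eta> / (6 * chi)\<close> cancels the
  amplification \<open>3 * chi\<close> of the tracking increments up to \<open>\<eta> / 2\<close>; and half the contraction rate,
  \<open>1 / (2 * chi)\<close>, times \<open>50 * chi * \<eta> * M\<close> is \<open>25 * \<eta> * M\<close>, which covers \<open>24 * \<eta> * M\<close> from the
  displacement of \<open>x\<close> and \<open>\<eta> * L\<^sup>2\<close> from the descent error.
\<close>

definition potential :: "('a, 'm) gt_state \<Rightarrow> real" where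
  "potential = (\<lambda>(x, y, v). F (node_avg x) + 2 * \<eta> / p * (norm (y - G x))\<^sup>2
     + 50 * chi * \<eta> * M * (norm (deviation x))\<^sup>2 + \<eta> / (6 * chi) * (norm (deviation v))\<^sup>2)"

definition valid :: "('a, 'm) gt_state \<Rightarrow> bool" where
  "valid = (\<lambda>(x, y, v). (\<forall>i. x $ i \<in> V \<and> y $ i \<in> V \<and> v $ i \<in> V) \<and> node_avg v = node_avg y)"

definition grad_sq :: "('a, 'm) gt_state \<Rightarrow> real" where
  "grad_sq s = (norm (grad V F (node_avg (fst s))))\<^sup>2"

abbreviation step :: "nat \<Rightarrow> ('a, 'm) gt_state \<Rightarrow> ('a, 'm) gt_state pmf" where
  "step k \<equiv> gt_page_step V n f b p \<eta> (W k)"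

definition next_x :: "nat \<Rightarrow> ('a, 'm) gt_state \<Rightarrow> 'a ^ 'm" where
  "next_x k = (\<lambda>(x, y, v). kron_apply (mat 1 - W k) x - \<eta> *\<^sub>R v)"

definition next_state :: "nat \<Rightarrow> ('a, 'm) gt_state \<Rightarrow> 'a ^ 'm \<Rightarrow> ('a, 'm) gt_state" where
  "next_state k s y' = (case s of (x, y, v) \<Rightarrow>
     (next_x k s, y', kron_apply (mat 1 - W k) v + y' - y))"

lemma step_eq:
  "step k (x, y, v) = do {
     S \<leftarrow> batch;
     c \<leftarrow> bernoulli_pmf p;
     return_pmf (next_state k (x, y, v)
       (if c then G (next_x k (x, y, v))
        else gt_page_minibatch V f b S x (next_x k (x, y, v)) y))
   }"
  by (simp add: gt_page_step_def Let_def next_state_def next_x_def batch_def cong: if_cong)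

lemma finite_set_step: "finite (set_pmf (step k s))"
  by (cases s) (simp add: step_eq finite_set_batch)

lemma expectation_step:
  "measure_pmf.expectation (step k (x, y, v)) h =
     measure_pmf.expectation batch (\<lambda>S.
       p * h (next_state k (x, y, v) (G (next_x k (x, y, v))))
       + (1 - p) * h (next_state k (x, y, v)
           (gt_page_minibatch V f b S x (next_x k (x, y, v)) y)))"
  using p by (simp add: step_eq expectation_bind_finite finite_set_batch mult.commute)

lemma next_x_in_V:
  assumes "valid (x, y, v)"
  shows "next_x k (x, y, v) $ i \<in> V"
  using assms V by (auto simp: next_x_def valid_def kron_apply_in_subspace
      intro!: subspace_diff subspace_scale)

lemma minibatch_in_V:
  assumes "S \<in> set_pmf batch" "\<And>i. x $ i \<in> V" "\<And>i. x' $ i \<in> V" "\<And>i. y $ i \<in> V"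
  shows "gt_page_minibatch V f b S x x' y $ i \<in> V"
  using assms V batch_range[OF assms(1)] has_gradsD(1)[OF f]
  by (auto simp: gt_page_minibatch_def
      intro!: subspace_add subspace_scale subspace_sum subspace_diff)

text \<open>Gossip preserves averages, so \<open>v\<close> and \<open>y\<close>, which receive the same increment, keep equal averages.\<close>

lemma valid_next_state:
  assumes "valid (x, y, v)" "\<And>i. y' $ i \<in> V"
  shows "valid (next_state k (x, y, v) y')"
  using assms V next_x_in_V[OF assms(1)]
  by (auto simp: valid_def next_state_def kron_apply_in_subspace node_avg_add node_avg_diff
      kron_apply_mat_minus node_avg_kron intro!: subspace_add subspace_diff)

lemma valid_step:
  assumes "valid s" "t \<in> set_pmf (step k s)"
  shows "valid t"
proof -
  obtain x y v where s: "s = (x, y, v)" by (cases s)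
  have xy: "x $ i \<in> V" "y $ i \<in> V" for i using assms(1) by (auto simp: s valid_def)
  from assms(2) obtain S c where "S \<in> set_pmf batch"
    and t: "t = next_state k (x, y, v) (if c then G (next_x k (x, y, v))
       else gt_page_minibatch V f b S x (next_x k (x, y, v)) y)"
    unfolding s step_eq by auto
  then show ?thesis
    using assms(1) next_x_in_V xy unfolding t s
    by (intro valid_next_state) (auto intro!: stacked_grad_in_V minibatch_in_V)
qed

text \<open>
  The estimator \<open>y\<close> is compared once with the new gradients, in which the old estimation error
  persists, and once with the old \<open>y\<close>, in which only the change of the gradients persists.
\<close>

lemma minibatch_errors:
  fixes x x' y :: "'a ^ 'm"
  assumes x: "\<And>i. x $ i \<in> V" and x': "\<And>i. x' $ i \<in> V"
  shows "measure_pmf.expectation batch (\<lambda>S. (norm (gt_page_minibatch V f b S x x' y - G x'))\<^sup>2)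
      \<le> (norm (y - G x))\<^sup>2 + Lhat\<^sup>2 / real b * (norm (x' - x))\<^sup>2"
    and "measure_pmf.expectation batch (\<lambda>S. (norm (gt_page_minibatch V f b S x x' y - y))\<^sup>2)
      \<le> (L\<^sup>2 + Lhat\<^sup>2 / real b) * (norm (x' - x))\<^sup>2"
proof -
  show "measure_pmf.expectation batch (\<lambda>S. (norm (gt_page_minibatch V f b S x x' y - G x'))\<^sup>2)
      \<le> (norm (y - G x))\<^sup>2 + Lhat\<^sup>2 / real b * (norm (x' - x))\<^sup>2"
    using minibatch_variance[OF x x', of "y - G x" y] by simp
  show "measure_pmf.expectation batch (\<lambda>S. (norm (gt_page_minibatch V f b S x x' y - y))\<^sup>2)
      \<le> (L\<^sup>2 + Lhat\<^sup>2 / real b) * (norm (x' - x))\<^sup>2"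
    using minibatch_variance[OF x x', of "G x' - G x" y] stacked_grad_lipschitz[OF x' x]
    by (simp add: distrib_right)
qed

lemma M_pos: "M > 0" and L_sq_le_M: "L\<^sup>2 \<le> M"
  using L p by (auto simp: M_def intro!: add_pos_nonneg)

text \<open>
  One step of the estimator. The tracking increment \<open>y' - y\<close> enters through the consensus error of
  \<open>v\<close>. With probability \<open>p\<close> the estimation error vanishes, and this decrease pays both for the
  increment that a refresh causes and for the error term in the descent inequality.
\<close>

lemma estimator_step:
  fixes x x' y :: "'a ^ 'm"
  assumes x: "\<And>i. x $ i \<in> V" and x': "\<And>i. x' $ i \<in> V"
  defines "T \<equiv> \<lambda>y'. 2 * \<eta> / p * (norm (y' - G x'))\<^sup>2 + \<eta> / 2 * (norm (y' - y))\<^sup>2"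
  shows "p * T (G x')
      + (1 - p) * measure_pmf.expectation batch (\<lambda>S. T (gt_page_minibatch V f b S x x' y))
    \<le> (2 * \<eta> / p - \<eta>) * (norm (y - G x))\<^sup>2 + 3 * \<eta> * M * (norm (x' - x))\<^sup>2"
proof -
  define D where "D = (norm (x' - x))\<^sup>2"
  define e where "e = (norm (y - G x))\<^sup>2"
  define q where "q = Lhat\<^sup>2 / real b"
  have q: "(1 - p) * q = p * (M - L\<^sup>2)" using p by (simp add: M_def q_def)
  have De: "D \<ge> 0" "e \<ge> 0" by (simp_all add: D_def e_def)
  have "(norm (G x' - y))\<^sup>2 \<le> 2 * (norm (G x' - G x))\<^sup>2 + 2 * (norm (G x - y))\<^sup>2"
    using norm_add_squared_le2[of "G x' - G x" "G x - y"] by simp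
  also have "\<dots> \<le> 2 * (L\<^sup>2 * D) + 2 * e"
    using stacked_grad_lipschitz[OF x' x] by (simp add: D_def e_def norm_minus_commute)
  finally have "\<eta> / 2 * (norm (G x' - y))\<^sup>2 \<le> \<eta> / 2 * (2 * (L\<^sup>2 * D) + 2 * e)"
    using \<eta> by (intro mult_left_mono) auto
  then have refresh: "p * T (G x') \<le> p * (\<eta> * L\<^sup>2 * D + \<eta> * e)"
    using p by (intro mult_left_mono) (auto simp: T_def algebra_simps)
  have "measure_pmf.expectation batch (\<lambda>S. T (gt_page_minibatch V f b S x x' y))
    = 2 * \<eta> / p * measure_pmf.expectation batch (\<lambda>S. (norm (gt_page_minibatch V f b S x x' y - G x'))\<^sup>2)
      + \<eta> / 2 * measure_pmf.expectation batch (\<lambda>S. (norm (gt_page_minibatch V f b S x x' y - y))\<^sup>2)"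
    unfolding T_def by (simp add: integrable_measure_pmf_finite[OF finite_set_batch])
  also have "\<dots> \<le> 2 * \<eta> / p * (e + q * D) + \<eta> / 2 * ((L\<^sup>2 + q) * D)"
    using minibatch_errors[OF x x', of y] p \<eta> unfolding D_def e_def q_def
    by (intro add_mono mult_left_mono) auto
  finally have "(1 - p) * measure_pmf.expectation batch (\<lambda>S. T (gt_page_minibatch V f b S x x' y))
    \<le> (1 - p) * (2 * \<eta> / p * (e + q * D) + \<eta> / 2 * ((L\<^sup>2 + q) * D))"
    using p by (intro mult_left_mono) auto
  also have "\<dots> = 2 * \<eta> / p * ((1 - p) * e + (1 - p) * q * D)
      + \<eta> / 2 * (((1 - p) * L\<^sup>2 + (1 - p) * q) * D)"
  proof -
    have "a * (c * (e + q * D) + h * ((l + q) * D)) = c * (a * e + a * q * D) + h * ((a * l + a * q) * D)"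
      for a c h l :: real by (simp add: algebra_simps)
    then show ?thesis .
  qed
  also have "\<dots> = (2 * \<eta> / p - 2 * \<eta>) * e + 2 * \<eta> * (M - L\<^sup>2) * D
      + \<eta> / 2 * (((1 - p) * L\<^sup>2 + p * (M - L\<^sup>2)) * D)"
    using p unfolding q by (simp add: field_simps)
  finally have minibatch: "(1 - p) * measure_pmf.expectation batch (\<lambda>S. T (gt_page_minibatch V f b S x x' y))
    \<le> (2 * \<eta> / p - 2 * \<eta>) * e + 2 * \<eta> * (M - L\<^sup>2) * D
      + \<eta> / 2 * (((1 - p) * L\<^sup>2 + p * (M - L\<^sup>2)) * D)" .
  have "p * \<eta> * e \<le> \<eta> * e"
    using p \<eta> De by (simp add: mult_left_le_one_le)
  \<comment> \<open>The factor 3 leaves room: the coefficient is at most \<open>L\<^sup>2 + 5 / 2 * (M - L\<^sup>2)\<close>.\<close>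
  moreover have "(p * L\<^sup>2 + 2 * (M - L\<^sup>2) + ((1 - p) * L\<^sup>2 + p * (M - L\<^sup>2)) / 2) * (\<eta> * D)
      \<le> 3 * M * (\<eta> * D)"
  proof (intro mult_right_mono)
    have "p * L\<^sup>2 \<le> 1 * L\<^sup>2" "p * (M - L\<^sup>2) \<le> 1 * (M - L\<^sup>2)"
      using p L_sq_le_M by (intro mult_right_mono; simp)+
    moreover have "A + 2 * (M - l) + ((l - A) + B) / 2 \<le> 3 * M"
      if "A \<le> 1 * l" "B \<le> 1 * (M - l)" "l \<le> M" "0 \<le> l" for A B l M :: real
      using that by (simp add: field_simps)
    ultimately show "p * L\<^sup>2 + 2 * (M - L\<^sup>2) + ((1 - p) * L\<^sup>2 + p * (M - L\<^sup>2)) / 2 \<le> 3 * M"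
      using L_sq_le_M by (simp only: left_diff_distrib mult_1 zero_le_power2)
    show "0 \<le> \<eta> * D" using \<eta> De by simp
  qed
  moreover have "p * (\<eta> * l * D + \<eta> * e) + (c * e + 2 * \<eta> * (M - l) * D + \<eta> / 2 * (h * D))
      = c * e + p * \<eta> * e + (p * l + 2 * (M - l) + h / 2) * (\<eta> * D)" for c h l
    by (simp add: algebra_simps)
  moreover have "(2 * \<eta> / p - 2 * \<eta>) * e + \<eta> * e = (2 * \<eta> / p - \<eta>) * e"
      "3 * M * (\<eta> * D) = 3 * \<eta> * M * D"
    by (simp_all add: algebra_simps)
  ultimately have "p * (\<eta> * L\<^sup>2 * D + \<eta> * e) + ((2 * \<eta> / p - 2 * \<eta>) * e + 2 * \<eta> * (M - L\<^sup>2) * D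
      + \<eta> / 2 * (((1 - p) * L\<^sup>2 + p * (M - L\<^sup>2)) * D)) \<le> (2 * \<eta> / p - \<eta>) * e + 3 * \<eta> * M * D"
    by (smt (verit))
  with refresh minibatch show ?thesis
    unfolding D_def[symmetric] e_def[symmetric] by linarith
qed

lemma displacement_le:
  assumes "valid (x, y, v)"
  shows "(norm (next_x k (x, y, v) - x))\<^sup>2
    \<le> 8 * (norm (deviation x))\<^sup>2
      + 2 * \<eta>\<^sup>2 * (real CARD('m) * (norm (node_avg y))\<^sup>2 + (norm (deviation v))\<^sup>2)"
proof -
  have x: "\<And>i. x $ i \<in> V" and v: "node_avg v = node_avg y"
    using assms by (auto simp: valid_def)
  have "(norm (next_x k (x, y, v) - x))\<^sup>2 = (norm (kron_apply (W k) x + \<eta> *\<^sub>R v))\<^sup>2"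
    using norm_minus_cancel[of "kron_apply (W k) x + \<eta> *\<^sub>R v"]
    by (simp add: next_x_def kron_apply_mat_minus)
  also have "\<dots> \<le> 2 * (norm (kron_apply (W k) x))\<^sup>2 + 2 * (norm (\<eta> *\<^sub>R v))\<^sup>2"
    by (rule norm_add_squared_le2)
  also have "\<dots> \<le> 2 * (4 * (norm (deviation x))\<^sup>2) + 2 * (\<eta>\<^sup>2 * (norm v)\<^sup>2)"
    using norm_kron_le[OF x, of k] by (simp add: power_mult_distrib)
  finally show ?thesis
    by (simp add: norm_squared_avg_deviation[of v] v)
qed

lemma step_size_le: "L * \<eta> \<le> 1 / 2" "1872 * \<eta>\<^sup>2 * M \<le> 1" "1872 * chi ^ 4 * \<eta>\<^sup>2 * M \<le> 1"
proof -
  show small: "1872 * chi ^ 4 * \<eta>\<^sup>2 * M \<le> 1"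
    using step_size by (simp add: M_def)
  have "1 * (1872 * \<eta>\<^sup>2 * M) \<le> chi ^ 4 * (1872 * \<eta>\<^sup>2 * M)"
    using chi M_pos by (intro mult_right_mono) (auto simp: one_le_power)
  with small show *: "1872 * \<eta>\<^sup>2 * M \<le> 1" by (simp add: mult_ac)
  have "\<eta>\<^sup>2 * L\<^sup>2 \<le> \<eta>\<^sup>2 * M" using L_sq_le_M by (simp add: mult_left_mono)
  also have "\<dots> \<le> (1 / 2)\<^sup>2" using * by (simp add: power2_eq_square)
  finally have "(L * \<eta>)\<^sup>2 \<le> (1 / 2)\<^sup>2" by (simp add: power_mult_distrib mult.commute)
  then show "L * \<eta> \<le> 1 / 2" by (rule power2_le_imp_le) simp
qed

text \<open>
  The mechanism of the proof: every error term that one step creates is dominated by the decrease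
  of another part of the potential. The consensus error of \<open>x\<close> contracts by \<open>1 / (2 * chi)\<close> and
  thereby absorbs its share of the displacement and of the descent error; the consensus error of
  \<open>v\<close> likewise absorbs what it feeds into \<open>x\<close>, which is where the step size restriction is needed;
  the descent term in the direction \<open>node_avg y\<close> absorbs the rest of the displacement.
\<close>

lemma potential_drift:
  assumes s: "valid s"
  shows "measure_pmf.expectation (step k s) potential
    \<le> potential s - \<eta> / (2 * real CARD('m)) * grad_sq s"
proof -
  obtain x y v where xyv: "s = (x, y, v)" by (cases s)
  have x: "\<And>i. x $ i \<in> V" and y: "\<And>i. y $ i \<in> V" and vV: "\<And>i. v $ i \<in> V"
    and v: "node_avg v = node_avg y"
    using s by (auto simp: valid_def xyv)
  define x' where "x' = next_x k (x, y, v)"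
  have x': "\<And>i. x' $ i \<in> V" using next_x_in_V s by (simp add: x'_def xyv)
  define \<Omega>x where "\<Omega>x = (norm (deviation x))\<^sup>2"
  define \<Omega>v where "\<Omega>v = (norm (deviation v))\<^sup>2"
  define w where "w = real CARD('m) * (norm (node_avg y))\<^sup>2"
  define e where "e = (norm (y - G x))\<^sup>2"
  define g where "g = \<eta> / (2 * real CARD('m)) * grad_sq s"
  have nonneg: "\<Omega>x \<ge> 0" "\<Omega>v \<ge> 0" "w \<ge> 0" "e \<ge> 0"
    by (simp_all add: \<Omega>x_def \<Omega>v_def w_def e_def)
  define K where "K = F (node_avg x') + 50 * chi * \<eta> * M * (norm (deviation x'))\<^sup>2
    + \<eta> / (6 * chi) * ((1 - 1 / (2 * chi)) * \<Omega>v)"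
  define T where "T y' = 2 * \<eta> / p * (norm (y' - G x'))\<^sup>2 + \<eta> / 2 * (norm (y' - y))\<^sup>2" for y'
  have next_potential: "potential (next_state k s y') \<le> K + T y'" for y'
  proof -
    have "(norm (deviation (kron_apply (mat 1 - W k) v + (y' - y))))\<^sup>2
      \<le> (1 - 1 / (2 * chi)) * \<Omega>v + 3 * chi * (norm (y' - y))\<^sup>2"
      using deviation_gossip_step[OF vV, of k "y' - y"] norm_deviation_le[of "y' - y"] chi
      unfolding \<Omega>v_def by (smt (verit, best) mult_left_mono)
    then have "\<eta> / (6 * chi) * (norm (deviation (kron_apply (mat 1 - W k) v + (y' - y))))\<^sup>2
      \<le> \<eta> / (6 * chi) * ((1 - 1 / (2 * chi)) * \<Omega>v + 3 * chi * (norm (y' - y))\<^sup>2)"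
      using \<eta> chi by (intro mult_left_mono) auto
    also have "\<dots> = \<eta> / (6 * chi) * ((1 - 1 / (2 * chi)) * \<Omega>v) + \<eta> / 2 * (norm (y' - y))\<^sup>2"
      using chi by (simp add: field_simps)
    finally show ?thesis
      by (simp add: potential_def next_state_def xyv K_def T_def x'_def[symmetric] add_diff_eq)
  qed
  have "measure_pmf.expectation (step k s) potential
    \<le> measure_pmf.expectation batch
        (\<lambda>S. p * (K + T (G x')) + (1 - p) * (K + T (gt_page_minibatch V f b S x x' y)))"
    unfolding xyv expectation_step x'_def[symmetric]
    using p next_potential unfolding xyv
    by (intro expectation_mono_finite finite_set_batch add_mono mult_left_mono) auto
  also have "\<dots> = K + (p * T (G x')
      + (1 - p) * measure_pmf.expectation batch (\<lambda>S. T (gt_page_minibatch V f b S x x' y)))"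
    by (simp add: integrable_measure_pmf_finite finite_set_batch) (simp add: algebra_simps)
  also have "\<dots> \<le> K + ((2 * \<eta> / p - \<eta>) * e + 3 * \<eta> * M * (norm (x' - x))\<^sup>2)"
    using estimator_step[OF x x', of y] unfolding T_def e_def by simp
  also have "\<dots> \<le> potential s - g"
  proof -
    have "node_avg x' = node_avg x - \<eta> *\<^sub>R node_avg y"
      by (simp add: x'_def next_x_def kron_apply_mat_minus node_avg_diff node_avg_kron
          node_avg_scaleR v)
    then have descent: "F (node_avg x')
        \<le> F (node_avg x) - g - (\<eta> / 2 - L * \<eta>\<^sup>2 / 2) * w + \<eta> * (e + L\<^sup>2 * \<Omega>x)"
      using obj_descent[of x y, OF x y]
      by (simp add: g_def grad_sq_def xyv w_def e_def \<Omega>x_def mult_ac)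
    have L: "\<eta> * (L\<^sup>2 * \<Omega>x) \<le> \<eta> * (M * \<Omega>x)"
      using \<eta> L_sq_le_M nonneg by (intro mult_left_mono mult_right_mono) auto
    have "(norm (deviation x'))\<^sup>2 \<le> (1 - 1 / (2 * chi)) * \<Omega>x + 3 * chi * (\<eta>\<^sup>2 * \<Omega>v)"
      using deviation_gossip_step[OF x, of k "- \<eta> *\<^sub>R v"]
      by (simp add: x'_def next_x_def \<Omega>x_def \<Omega>v_def deviation_scaleR[of "- \<eta>", simplified]
          power_mult_distrib)
    then have "50 * chi * \<eta> * M * (norm (deviation x'))\<^sup>2
        \<le> 50 * chi * \<eta> * M * ((1 - 1 / (2 * chi)) * \<Omega>x + 3 * chi * (\<eta>\<^sup>2 * \<Omega>v))"
      using chi \<eta> M_pos by (intro mult_left_mono) auto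
    also have "\<dots> = 50 * chi * \<eta> * M * \<Omega>x - 25 * (\<eta> * (M * \<Omega>x)) + 150 * (chi\<^sup>2 * (\<eta> ^ 3 * M) * \<Omega>v)"
      using chi by (simp add: field_simps power2_eq_square power3_eq_cube)
    finally have consensus: "50 * chi * \<eta> * M * (norm (deviation x'))\<^sup>2
        \<le> 50 * chi * \<eta> * M * \<Omega>x - 25 * (\<eta> * (M * \<Omega>x)) + 150 * (chi\<^sup>2 * (\<eta> ^ 3 * M) * \<Omega>v)" .
    have "3 * \<eta> * M * (norm (x' - x))\<^sup>2 \<le> 3 * \<eta> * M * (8 * \<Omega>x + 2 * \<eta>\<^sup>2 * (w + \<Omega>v))"
      using displacement_le[of x y v k] s \<eta> M_pos
      by (intro mult_left_mono) (auto simp: x'_def xyv \<Omega>x_def \<Omega>v_def w_def)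
    also have "\<dots> = 24 * (\<eta> * (M * \<Omega>x)) + 6 * (\<eta> ^ 3 * M * w) + 6 * (\<eta> ^ 3 * M * \<Omega>v)"
      by (simp add: algebra_simps power2_eq_square power3_eq_cube)
    finally have displacement: "3 * \<eta> * M * (norm (x' - x))\<^sup>2
        \<le> 24 * (\<eta> * (M * \<Omega>x)) + 6 * (\<eta> ^ 3 * M * w) + 6 * (\<eta> ^ 3 * M * \<Omega>v)" .
    have "1 * (\<eta> ^ 3 * M * \<Omega>v) \<le> chi\<^sup>2 * (\<eta> ^ 3 * M * \<Omega>v)"
      using chi \<eta> M_pos nonneg by (intro mult_right_mono) (auto simp: one_le_power)
    then have tracking1: "6 * (\<eta> ^ 3 * M * \<Omega>v) \<le> 6 * (chi\<^sup>2 * (\<eta> ^ 3 * M) * \<Omega>v)"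
      by (simp add: mult_ac)
    \<comment> \<open>150 comes from the input of \<open>v\<close> into \<open>x\<close>, 6 from the displacement, and 1872 = 12 * 156.\<close>
    have "156 * (chi\<^sup>2 * (\<eta> ^ 3 * M) * \<Omega>v)
        = (1872 * chi ^ 4 * \<eta>\<^sup>2 * M) * (\<eta> / (12 * chi\<^sup>2) * \<Omega>v)"
      using chi by (simp add: field_simps power2_eq_square power3_eq_cube power4_eq_xxxx)
    also have "\<dots> \<le> 1 * (\<eta> / (12 * chi\<^sup>2) * \<Omega>v)"
      using \<eta> chi nonneg step_size_le(3) by (intro mult_right_mono) auto
    finally have tracking2: "156 * (chi\<^sup>2 * (\<eta> ^ 3 * M) * \<Omega>v) \<le> \<eta> / (12 * chi\<^sup>2) * \<Omega>v" by simp
    have "6 * (\<eta> ^ 3 * M) = \<eta> / 312 * (1872 * \<eta>\<^sup>2 * M)"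
      by (simp add: power2_eq_square power3_eq_cube)
    also have "\<dots> \<le> \<eta> / 312 * 1"
      using \<eta> step_size_le(2) by (intro mult_left_mono) auto
    also have "\<dots> \<le> \<eta> / 2 - \<eta> / 2 * (L * \<eta>)"
      using mult_left_mono[OF step_size_le(1), of "\<eta> / 2"] \<eta> by simp
    finally have "6 * (\<eta> ^ 3 * M) * w \<le> (\<eta> / 2 - L * \<eta>\<^sup>2 / 2) * w"
      using nonneg by (intro mult_right_mono) (auto simp: power2_eq_square mult_ac)
    then have movement: "6 * (\<eta> ^ 3 * M * w) \<le> (\<eta> / 2 - L * \<eta>\<^sup>2 / 2) * w" by simp
    have K: "K = F (node_avg x') + 50 * chi * \<eta> * M * (norm (deviation x'))\<^sup>2
        + \<eta> / (6 * chi) * \<Omega>v - \<eta> / (12 * chi\<^sup>2) * \<Omega>v"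
      using chi by (simp add: K_def field_simps power2_eq_square)
    have pot: "potential s = F (node_avg x) + 2 * \<eta> / p * e + 50 * chi * \<eta> * M * \<Omega>x + \<eta> / (6 * chi) * \<Omega>v"
      by (simp add: potential_def xyv e_def \<Omega>x_def \<Omega>v_def)
    have split: "(2 * \<eta> / p - \<eta>) * e = 2 * \<eta> / p * e - \<eta> * e"
        "\<eta> * (e + L\<^sup>2 * \<Omega>x) = \<eta> * e + \<eta> * (L\<^sup>2 * \<Omega>x)"
      by (simp_all add: algebra_simps)
    have balance: "F' + Cx + tv - qv + (te - de + Dx) \<le> F0 + te + cx + tv - g"
      if "F' \<le> F0 - g - dw + (de + lx)" "lx \<le> ax" "Cx \<le> cx - 25 * ax + 150 * av"
        "Dx \<le> 24 * ax + 6 * bw + 6 * bv" "6 * bv \<le> 6 * av" "156 * av \<le> qv" "6 * bw \<le> dw"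
      for F' Cx tv qv te de Dx F0 cx g dw lx ax av bw bv :: real
      using that by linarith
    show ?thesis unfolding K pot split(1)
      by (rule balance[OF descent[unfolded split(2)] L consensus displacement tracking1 tracking2 movement])
  qed
  finally show ?thesis by (simp add: g_def)
qed

section \<open>The trajectory\<close>

abbreviation run :: "'a \<Rightarrow> nat \<Rightarrow> (nat \<Rightarrow> ('a, 'm) gt_state) pmf" where
  "run x0 k \<equiv> gt_page_run V n f b p \<eta> W x0 k"

lemma finite_set_run: "finite (set_pmf (run x0 k))"
  by (induction k) (auto simp: finite_set_step)

text \<open>All nodes start at the same point, with exact gradients and equal blocks of \<open>v\<close>, so no error term occurs.\<close>

lemma potential_init: "potential (gt_page_init V n f x0) = F x0"
  by (simp add: gt_page_init_def Let_def potential_def node_avg_const deviation_const)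

lemma valid_init: "x0 \<in> V \<Longrightarrow> valid (gt_page_init V n f x0)"
  using V by (simp add: gt_page_init_def Let_def valid_def node_avg_const stacked_grad_in_V
      node_avg_in_subspace)

lemma valid_run: "x0 \<in> V \<Longrightarrow> s \<in> set_pmf (run x0 k) \<Longrightarrow> valid (s k)"
proof (induction k arbitrary: s)
  case 0
  then show ?case by (simp add: valid_init)
next
  case (Suc k)
  from Suc.prems(2) obtain s' t where "s' \<in> set_pmf (run x0 k)" "t \<in> set_pmf (step k (s' k))"
    and "s = s'(Suc k := t)"
    unfolding gt_page_run.simps set_bind_pmf set_return_pmf by blast
  with Suc show ?case by (auto intro: valid_step)
qed

text \<open>
  The drift inequality telescopes; carrying the past gradient norms inside the expectation makes
  this a plain induction on the number of steps.
\<close>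

lemma expected_potential_run:
  assumes "x0 \<in> V"
  shows "measure_pmf.expectation (run x0 k)
      (\<lambda>s. potential (s k) + \<eta> / (2 * real CARD('m)) * (\<Sum>j<k. grad_sq (s j))) \<le> F x0"
proof (induction k)
  case 0
  then show ?case by (simp add: potential_init)
next
  case (Suc k)
  let ?c = "\<eta> / (2 * real CARD('m))"
  let ?sum = "\<lambda>s. ?c * (\<Sum>j<Suc k. grad_sq (s j))"
  have "measure_pmf.expectation (run x0 (Suc k)) (\<lambda>s. potential (s (Suc k)) + ?sum s)
    = measure_pmf.expectation (run x0 k)
        (\<lambda>s. measure_pmf.expectation (step k (s k)) (\<lambda>t. potential t + ?sum s))"
    by (simp add: expectation_bind_finite finite_set_run finite_set_step)
  also have "\<dots> = measure_pmf.expectation (run x0 k)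
        (\<lambda>s. measure_pmf.expectation (step k (s k)) potential + ?sum s)"
    by (simp add: integrable_measure_pmf_finite finite_set_step)
  also have "\<dots> \<le> measure_pmf.expectation (run x0 k) (\<lambda>s. potential (s k) + ?c * (\<Sum>j<k. grad_sq (s j)))"
  proof (intro expectation_mono_finite finite_set_run)
    fix s assume "s \<in> set_pmf (run x0 k)"
    from potential_drift[OF valid_run[OF assms this], of k]
    show "measure_pmf.expectation (step k (s k)) potential + ?sum s
        \<le> potential (s k) + ?c * (\<Sum>j<k. grad_sq (s j))"
      by (simp add: distrib_left)
  qed
  finally show ?case using Suc.IH by linarith
qed

lemma expectation_output:
  assumes "N \<ge> 1"
  shows "measure_pmf.expectation (gt_page_output V n f b p \<eta> W x0 N) (\<lambda>z. (norm (grad V F z))\<^sup>2)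
    = measure_pmf.expectation (run x0 N) (\<lambda>s. \<Sum>k<N. grad_sq (s k)) / real N"
proof -
  have "{..<N} \<noteq> {}" using assms by (auto simp: lessThan_empty_iff)
  then show ?thesis
    by (simp add: gt_page_output_def expectation_bind_finite finite_set_run integral_pmf_of_set
        grad_sq_def)
qed

lemma expected_gradient_output:
  assumes x0: "x0 \<in> V" and N: "N \<ge> 1" and bdd: "bdd_below (F ` V)"
  shows "measure_pmf.expectation (gt_page_output V n f b p \<eta> W x0 N) (\<lambda>z. (norm (grad V F z))\<^sup>2)
    \<le> 2 * real CARD('m) * (F x0 - (INF u\<in>V. F u)) / (\<eta> * real N)"
proof -
  let ?c = "\<eta> / (2 * real CARD('m))" and ?Fmin = "INF u\<in>V. F u"
  let ?E = "measure_pmf.expectation (run x0 N) (\<lambda>s. \<Sum>k<N. grad_sq (s k))"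
  have "?Fmin + ?c * ?E = measure_pmf.expectation (run x0 N)
      (\<lambda>s. ?Fmin + ?c * (\<Sum>k<N. grad_sq (s k)))"
    by (simp add: integrable_measure_pmf_finite finite_set_run)
  also have "\<dots> \<le> measure_pmf.expectation (run x0 N)
      (\<lambda>s. potential (s N) + ?c * (\<Sum>k<N. grad_sq (s k)))"
  proof (intro expectation_mono_finite finite_set_run add_right_mono)
    fix s assume "s \<in> set_pmf (run x0 N)"
    then have s: "valid (s N)" using valid_run x0 by blast
    obtain x y v where xyv: "s N = (x, y, v)" by (cases "s N")
    have "node_avg x \<in> V" using s V by (simp add: xyv valid_def node_avg_in_subspace)
    then have "?Fmin \<le> F (node_avg x)" using bdd by (intro cINF_lower)
    then show "?Fmin \<le> potential (s N)"
      using \<eta> p chi M_pos by (simp add: xyv potential_def add_nonneg_nonneg add_increasing2)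
  qed
  also have "\<dots> \<le> F x0" by (rule expected_potential_run[OF x0])
  finally have "?c * ?E \<le> F x0 - ?Fmin" by simp
  then have "?E \<le> 2 * real CARD('m) * (F x0 - ?Fmin) / \<eta>"
    using \<eta> by (simp add: field_simps)
  then have "?E / real N \<le> 2 * real CARD('m) * (F x0 - ?Fmin) / \<eta> / real N"
    by (intro divide_right_mono) auto
  then show ?thesis unfolding expectation_output[OF N] by (simp add: mult.commute)
qed

end

section \<open>The iteration bound\<close>

theorem theorem4p3:
  shows "\<exists>C>0. \<forall>(chi::real) (L::real) (Lhat::real) (b::nat) (p::real).
    chi \<ge> 1 \<and> L > 0 \<and> Lhat \<ge> 0 \<and> b \<ge> 1 \<and> 0 < p \<and> p \<le> 1 \<longrightarrow>
    (\<exists>\<eta>>0. \<forall>(d::nat) (n::nat) (f :: 'm::finite \<Rightarrow> nat \<Rightarrow> fseq \<Rightarrow> real)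
        (E :: nat \<Rightarrow> ('m \<times> 'm) set) (W :: nat \<Rightarrow> real ^ 'm ^ 'm) (x0::fseq) (\<epsilon>::real) (N::nat).
      d \<ge> 1 \<longrightarrow> n \<ge> 1 \<longrightarrow>
      (\<forall>i. \<forall>j\<in>{1..n}. f i j differentiable_on Rd d) \<longrightarrow>
      (\<forall>i. L_smooth (Rd d) (node_obj n f i) L) \<longrightarrow>
      (\<forall>i. average_smooth (Rd d) n (f i) Lhat) \<longrightarrow>
      bdd_below (obj n f ` Rd d) \<longrightarrow>
      gossip (Rd d) E W chi \<longrightarrow>
      x0 \<in> Rd d \<longrightarrow> \<epsilon> > 0 \<longrightarrow> N \<ge> 1 \<longrightarrow>
      real N \<ge> C * (chi ^ 3 * L * (obj n f x0 - (INF u\<in>Rd d. obj n f u)) *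
                  (1 + sqrt ((1 - p) * Lhat\<^sup>2 / (real b * p * L\<^sup>2))) / \<epsilon>\<^sup>2) \<longrightarrow>
      measure_pmf.expectation (gt_page_output (Rd d) n f b p \<eta> W x0 N)
        (\<lambda>z. (norm (grad (Rd d) (obj n f) z))\<^sup>2) \<le> \<epsilon>\<^sup>2)"
proof (rule exI[of _ "88 * real CARD('m)"], intro conjI allI impI)
  show "0 < 88 * real CARD('m)" by simp
  fix chi L Lhat p :: real and b :: nat
  assume "1 \<le> chi \<and> 0 < L \<and> 0 \<le> Lhat \<and> 1 \<le> b \<and> 0 < p \<and> p \<le> 1"
  then have par: "1 \<le> chi" "0 < L" "0 \<le> Lhat" "1 \<le> b" "0 < p" "p \<le> 1" by auto
  define s where "s = sqrt ((1 - p) * Lhat\<^sup>2 / (real b * p * L\<^sup>2))"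
  have s: "s \<ge> 0" using par by (simp add: s_def)
  \<comment> \<open>The factor 44 meets the step size restriction since 44 squared is 1936, which exceeds 1872.\<close>
  define \<eta> where "\<eta> = 1 / (44 * chi ^ 3 * L * (1 + s))"
  have \<eta>: "\<eta> > 0" using par s by (simp add: \<eta>_def)
  have "L\<^sup>2 + (1 - p) * Lhat\<^sup>2 / (real b * p) = L\<^sup>2 * (1 + s\<^sup>2)"
  proof -
    have "s\<^sup>2 = (1 - p) * Lhat\<^sup>2 / (real b * p * L\<^sup>2)"
      unfolding s_def using par by (intro real_sqrt_pow2) simp
    then show ?thesis using par by (simp add: field_simps)
  qed
  also have "\<dots> \<le> L\<^sup>2 * (1 + s)\<^sup>2"
    using s by (intro mult_left_mono) (auto simp: power2_sum)
  finally have "1872 * chi ^ 4 * \<eta>\<^sup>2 * (L\<^sup>2 + (1 - p) * Lhat\<^sup>2 / (real b * p))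
      \<le> 1872 * chi ^ 4 * \<eta>\<^sup>2 * (L\<^sup>2 * (1 + s)\<^sup>2)"
    by (intro mult_left_mono) auto
  also have "\<dots> = 1872 / (1936 * chi\<^sup>2)"
    using par s by (simp add: \<eta>_def power_mult_distrib power_divide flip: power_mult)
      (simp add: field_simps power2_eq_square eval_nat_numeral)
  also have "\<dots> \<le> 1"
  proof -
    have "1 \<le> chi\<^sup>2" using par by (intro one_le_power)
    then show ?thesis by (simp add: divide_le_eq)
  qed
  finally have step_size: "1872 * chi ^ 4 * \<eta>\<^sup>2 * (L\<^sup>2 + (1 - p) * Lhat\<^sup>2 / (real b * p)) \<le> 1" .
  show "\<exists>\<eta>>0. \<forall>(d::nat) (n::nat) (f :: 'm::finite \<Rightarrow> nat \<Rightarrow> fseq \<Rightarrow> real)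
        (E :: nat \<Rightarrow> ('m \<times> 'm) set) (W :: nat \<Rightarrow> real ^ 'm ^ 'm) (x0::fseq) (\<epsilon>::real) (N::nat).
      d \<ge> 1 \<longrightarrow> n \<ge> 1 \<longrightarrow>
      (\<forall>i. \<forall>j\<in>{1..n}. f i j differentiable_on Rd d) \<longrightarrow>
      (\<forall>i. L_smooth (Rd d) (node_obj n f i) L) \<longrightarrow>
      (\<forall>i. average_smooth (Rd d) n (f i) Lhat) \<longrightarrow>
      bdd_below (obj n f ` Rd d) \<longrightarrow>
      gossip (Rd d) E W chi \<longrightarrow>
      x0 \<in> Rd d \<longrightarrow> \<epsilon> > 0 \<longrightarrow> N \<ge> 1 \<longrightarrow>
      real N \<ge> 88 * real CARD('m) * (chi ^ 3 * L * (obj n f x0 - (INF u\<in>Rd d. obj n f u)) *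
                  (1 + sqrt ((1 - p) * Lhat\<^sup>2 / (real b * p * L\<^sup>2))) / \<epsilon>\<^sup>2) \<longrightarrow>
      measure_pmf.expectation (gt_page_output (Rd d) n f b p \<eta> W x0 N)
        (\<lambda>z. (norm (grad (Rd d) (obj n f) z))\<^sup>2) \<le> \<epsilon>\<^sup>2"
    unfolding s_def[symmetric]
  proof (intro exI[of _ \<eta>] conjI allI impI)
    fix d n :: nat and f :: "'m \<Rightarrow> nat \<Rightarrow> fseq \<Rightarrow> real"
      and E :: "nat \<Rightarrow> ('m \<times> 'm) set" and W :: "nat \<Rightarrow> real ^ 'm ^ 'm"
      and x0 :: fseq and \<epsilon> :: real and N :: nat
    assume n: "1 \<le> n"
      and diff: "\<forall>i. \<forall>j\<in>{1..n}. f i j differentiable_on Rd d"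
      and smooth: "\<forall>i. L_smooth (Rd d) (node_obj n f i) L"
      and average: "\<forall>i. average_smooth (Rd d) n (f i) Lhat"
      and bdd: "bdd_below (obj n f ` Rd d)"
      and gossip: "gossip (Rd d) E W chi"
      and x0: "x0 \<in> Rd d" and \<epsilon>: "0 < \<epsilon>" and N: "1 \<le> N"
    let ?\<Delta> = "obj n f x0 - (INF u\<in>Rd d. obj n f u)"
    assume large: "88 * real CARD('m) * (chi ^ 3 * L * ?\<Delta> * (1 + s) / \<epsilon>\<^sup>2) \<le> real N"
    interpret gt_page "Rd d" E W chi n f L Lhat b p \<eta>
      using par n diff smooth average gossip \<eta> step_size
      by unfold_locales (auto intro: subspace_Rd has_grads_Rd)
    have "measure_pmf.expectation (gt_page_output (Rd d) n f b p \<eta> W x0 N)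
        (\<lambda>z. (norm (grad (Rd d) (obj n f) z))\<^sup>2) \<le> 2 * real CARD('m) * ?\<Delta> / (\<eta> * real N)"
      by (rule expected_gradient_output[OF x0 N bdd])
    also have "\<dots> = 88 * real CARD('m) * (chi ^ 3 * L * ?\<Delta> * (1 + s)) / real N"
      by (simp add: \<eta>_def)
    also have "\<dots> \<le> \<epsilon>\<^sup>2"
      using large N \<epsilon> by (simp add: field_simps)
    finally show "measure_pmf.expectation (gt_page_output (Rd d) n f b p \<eta> W x0 N)
        (\<lambda>z. (norm (grad (Rd d) (obj n f) z))\<^sup>2) \<le> \<epsilon>\<^sup>2" .
  qed (rule \<eta>)
qed

end
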